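(* Consider any solution of the fully discrete MHD scheme (a)–(g) described in the context in the ideal MHD limit, i.e. with $R_e^{-1}=R_m^{-1}=0$, and with initial data satisfying $\nabla\cdot\bm{B}_h^0=0$. Assume that $(\bm{f},\bm{H}_h)=0$ at every time step. For each $n$ let $\bm{A}_h^n\in H_0^h(\mathrm{curl},\Omega)$ be any vector potential with $\nabla\times\bm{A}_h^n=\bm{B}_h^n$. Then the magnetic and cross helicity are conserved: $$D_t\int_\Omega\bm{B}_h\cdot\bm{A}_h\,dx=0,\qquad D_t\int_\Omega\bm{B}_h\cdot\bm{u}_h\,dx=0,$$ i.e. for all $n\ge 0$, $$\int_\Omega\bm{B}_h^n\cdot\bm{A}_h^n\,dx=\cdots=\int_\Omega\bm{B}_h^0\cdot\bm{A}_h^0\,dx,\qquad \int_\Omega\bm{B}_h^n\cdot\bm{u}_h^n\,dx=\cdots=\int_\Omega\bm{B}_h^0\cdot\bm{u}_h^0\,dx.$$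
   Context: $\Omega\subset\mathbb{R}^3$ is a contractible bounded Lipschitz domain with unit outer normal $\bm{n}$; $(\cdot,\cdot)$ and $\|\cdot\|$ are the $L^2(\Omega)$ inner product and norm. $H_0(\mathrm{grad},\Omega)$, $H_0(\mathrm{curl},\Omega)$, $H_0(\mathrm{div},\Omega)$ are the usual spaces of $L^2$ fields with $L^2$ gradient/curl/divergence and vanishing trace $v$, $v\times \bm{n}$, $v\cdot\bm{n}$ on $\partial\Omega$, respectively; $L^2_0(\Omega)$ is the space of mean-zero $L^2$ functions. $H_0^h(\mathrm{grad},\Omega)$, $H_0^h(\mathrm{curl},\Omega)$, $H_0^h(\mathrm{div},\Omega)$, $L_0^{2,h}(\Omega)$ are finite-dimensional (piecewise polynomial finite element) subspaces of these spaces forming a discrete de Rham complex $$0\to H_0^h(\mathrm{grad},\Omega)\xrightarrow{\mathrm{grad}} H_0^h(\mathrm{curl},\Omega)\xrightarrow{\mathrm{curl}} H_0^h(\mathrm{div},\Omega)\xrightarrow{\mathrm{div}} L_0^{2,h}(\Omega)\to 0,$$ which is exact. Scheme. Let $\Delta t>0$ be the time step, $\mathsf{c}>0$ the coupling number, $R_e,R_m\in(0,\infty]$ the fluid and magnetic Reynolds numbers (with $R^{-1}=0$ when $R=\infty$), and $\bm{f}\in [L^2(\Omega)]^3$ a given source (evaluated at the midpoint of each time interval). Given $(\bm{u}_h^0,\bm{B}_h^0)\in H_0^h(\mathrm{curl},\Omega)\times H_0^h(\mathrm{div},\Omega)$, for $n=0,1,2,\dots$ one seeks $\bm{u}_h^{n+1},\bm{\omega}_h^{n+1/2},\bm{j}_h^{n+1/2},\bm{E}_h^{n+1/2},\bm{H}_h^{n+1/2}\in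 H_0^h(\mathrm{curl},\Omega)$, $\bm{B}_h^{n+1}\in H_0^h(\mathrm{div},\Omega)$, $P_h^{n+1/2}\in H_0^h(\mathrm{grad},\Omega)$ such that for all $\bm{v}_h,\bm{\mu}_h,\bm{k}_h,\bm{F}_h,\bm{G}_h\in H_0^h(\mathrm{curl},\Omega)$, $\bm{C}_h\in H_0^h(\mathrm{div},\Omega)$, $Q_h\in H_0^h(\mathrm{grad},\Omega)$: (a) $(D_t\bm{u}_h,\bm{v}_h)-(\bm{u}_h\times\bm{\omega}_h,\bm{v}_h)+R_e^{-1}(\nabla\times\bm{u}_h,\nabla\times\bm{v}_h)+(\nabla P_h,\bm{v}_h)-\mathsf{c}(\bm{j}_h\times\bm{H}_h,\bm{v}_h)=(\bm{f},\bm{v}_h)$; (b) $(D_t\bm{B}_h,\bm{C}_h)+(\nabla\times\bm{E}_h,\bm{C}_h)=0$; (c) $(R_m^{-1}\bm{j}_h-[\bm{E}_h+\bm{u}_h\times\bm{H}_h],\bm{G}_h)=0$; (d) $(\bm{\omega}_h,\bm{\mu}_h)-(\nabla\times\bm{u}_h,\bm{\mu}_h)=0$; (e) $(\bm{j}_h,\bm{k}_h)-(\bm{B}_h,\nabla\times\bm{k}_h)=0$; (f) $(\bm{B}_h,\bm{F}_h)-(\bm{H}_h,\bm{F}_h)=0$; (g) $(\bm{u}_h,\nabla Q_h)=0$. Here $D_t\bm{u}_h=(\bm{u}_h^{n+1}-\bm{u}_h^n)/\Delta t$, $D_t\bm{B}_h=(\bm{B}_h^{n+1}-\bm{B}_h^n)/\Delta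 t$, $\bm{u}_h=(\bm{u}_h^{n+1}+\bm{u}_h^n)/2$, $\bm{B}_h=(\bm{B}_h^{n+1}+\bm{B}_h^n)/2$, and $\bm{\omega}_h,\bm{j}_h,\bm{E}_h,\bm{H}_h,P_h$ denote the midpoint unknowns with superscript $n+1/2$. For integrals of products, $D_t\int_\Omega\bm{a}\cdot\bm{b}\,dx:=\frac{1}{\Delta t}\left(\int_\Omega\bm{a}^{n+1}\cdot\bm{b}^{n+1}\,dx-\int_\Omega\bm{a}^{n}\cdot\bm{b}^{n}\,dx\right)$. *)

theory Defs
  imports "HOL-Analysis.Analysis"
begin

type_synonym scalar_field = "real^3 \<Rightarrow> real"
type_synonym vector_field = "real^3 \<Rightarrow> real^3"

text \<open>Near each boundary point, and after a rigid motion, the domain is the part of a ball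
  lying strictly above the graph of a Lipschitz function of two variables.\<close>

definition lipschitz_domain :: "(real^3) set \<Rightarrow> bool" where
  "lipschitz_domain \<Omega> \<longleftrightarrow>
     open \<Omega> \<and> connected \<Omega> \<and> \<Omega> \<noteq> {} \<and>
     (\<forall>p\<in>frontier \<Omega>. \<exists>r>0. \<exists>Q :: real^3 \<Rightarrow> real^3. \<exists>g :: real^2 \<Rightarrow> real. \<exists>L.
        orthogonal_transformation Q \<and> L-lipschitz_on UNIV g \<and>
        \<Omega> \<inter> ball p r =
          {x \<in> ball p r. Q (x - p) $ 3 > g (vector [Q (x - p) $ 1, Q (x - p) $ 2])})"

definition pd :: "3 \<Rightarrow> scalar_field \<Rightarrow> scalar_field" where
  "pd i f x = frechet_derivative f (at x) (axis i 1)"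

primrec Ck :: "nat \<Rightarrow> scalar_field \<Rightarrow> bool" where
  "Ck 0 f \<longleftrightarrow> continuous_on UNIV f"
| "Ck (Suc k) f \<longleftrightarrow> (\<forall>x. f differentiable (at x)) \<and> (\<forall>i. Ck k (pd i f))"

definition smooth_scalar :: "scalar_field \<Rightarrow> bool" where
  "smooth_scalar \<phi> \<longleftrightarrow> (\<forall>k. Ck k \<phi>)"

definition smooth_vector :: "vector_field \<Rightarrow> bool" where
  "smooth_vector \<phi> \<longleftrightarrow> (\<forall>i. smooth_scalar (\<lambda>x. \<phi> x $ i))"

definition compactly_supported_in :: "(real^3) set \<Rightarrow> (real^3 \<Rightarrow> 'b::zero) \<Rightarrow> bool" where
  "compactly_supported_in \<Omega> \<phi> \<longleftrightarrow>
     compact (closure {x. \<phi> x \<noteq> 0}) \<and> closure {x. \<phi> x \<noteq> 0} \<subseteq> \<Omega>"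

definition cgrad :: "scalar_field \<Rightarrow> vector_field" where
  "cgrad \<phi> x = (\<chi> i. pd i \<phi> x)"

definition ccurl :: "vector_field \<Rightarrow> vector_field" where
  "ccurl \<phi> x = vector
     [pd 2 (\<lambda>y. \<phi> y $ 3) x - pd 3 (\<lambda>y. \<phi> y $ 2) x,
      pd 3 (\<lambda>y. \<phi> y $ 1) x - pd 1 (\<lambda>y. \<phi> y $ 3) x,
      pd 1 (\<lambda>y. \<phi> y $ 2) x - pd 2 (\<lambda>y. \<phi> y $ 1) x]"

definition cdiv :: "vector_field \<Rightarrow> scalar_field" where
  "cdiv \<phi> x = (\<Sum>i\<in>UNIV. pd i (\<lambda>y. \<phi> y $ i) x)"

text \<open>Elements of \<open>L\<^sup>2(\<Omega>)\<close> are represented by functions on the whole space; only their values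
  on \<open>\<Omega>\<close>, up to null sets, matter.  Equality in \<open>L\<^sup>2(\<Omega>)\<close> is \<open>aeq \<Omega>\<close>.\<close>

definition L2 :: "(real^3) set \<Rightarrow> (real^3 \<Rightarrow> 'b::euclidean_space) set" where
  "L2 \<Omega> = {f \<in> borel_measurable (lebesgue_on \<Omega>).
             integrable (lebesgue_on \<Omega>) (\<lambda>x. (norm (f x))\<^sup>2)}"

definition aeq :: "(real^3) set \<Rightarrow> (real^3 \<Rightarrow> 'b) \<Rightarrow> (real^3 \<Rightarrow> 'b) \<Rightarrow> bool" where
  "aeq \<Omega> f g \<longleftrightarrow> (AE x in lebesgue_on \<Omega>. f x = g x)"

definition ip :: "(real^3) set \<Rightarrow> (real^3 \<Rightarrow> 'b::euclidean_space) \<Rightarrow> (real^3 \<Rightarrow> 'b) \<Rightarrow> real" where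
  "ip \<Omega> f g = integral\<^sup>L (lebesgue_on \<Omega>) (\<lambda>x. f x \<bullet> g x)"

definition L2_0 :: "(real^3) set \<Rightarrow> scalar_field set" where
  "L2_0 \<Omega> = {q \<in> L2 \<Omega>. integral\<^sup>L (lebesgue_on \<Omega>) q = 0}"

definition has_weak_grad :: "(real^3) set \<Rightarrow> scalar_field \<Rightarrow> vector_field \<Rightarrow> bool" where
  "has_weak_grad \<Omega> v w \<longleftrightarrow> w \<in> L2 \<Omega> \<and>
     (\<forall>\<phi>. smooth_vector \<phi> \<and> compactly_supported_in \<Omega> \<phi> \<longrightarrow> ip \<Omega> w \<phi> = - ip \<Omega> v (cdiv \<phi>))"

definition has_weak_curl :: "(real^3) set \<Rightarrow> vector_field \<Rightarrow> vector_field \<Rightarrow> bool" where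
  "has_weak_curl \<Omega> v w \<longleftrightarrow> w \<in> L2 \<Omega> \<and>
     (\<forall>\<phi>. smooth_vector \<phi> \<and> compactly_supported_in \<Omega> \<phi> \<longrightarrow> ip \<Omega> w \<phi> = ip \<Omega> v (ccurl \<phi>))"

definition has_weak_div :: "(real^3) set \<Rightarrow> vector_field \<Rightarrow> scalar_field \<Rightarrow> bool" where
  "has_weak_div \<Omega> v w \<longleftrightarrow> w \<in> L2 \<Omega> \<and>
     (\<forall>\<phi>. smooth_scalar \<phi> \<and> compactly_supported_in \<Omega> \<phi> \<longrightarrow> ip \<Omega> w \<phi> = - ip \<Omega> v (cgrad \<phi>))"

definition H_grad :: "(real^3) set \<Rightarrow> scalar_field set" where
  "H_grad \<Omega> = {v \<in> L2 \<Omega>. \<exists>w. has_weak_grad \<Omega> v w}"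

definition H_curl :: "(real^3) set \<Rightarrow> vector_field set" where
  "H_curl \<Omega> = {v \<in> L2 \<Omega>. \<exists>w. has_weak_curl \<Omega> v w}"

definition H_div :: "(real^3) set \<Rightarrow> vector_field set" where
  "H_div \<Omega> = {v \<in> L2 \<Omega>. \<exists>w. has_weak_div \<Omega> v w}"

text \<open>Weak derivatives are unique only up to null sets; the operators pick a representative.\<close>

definition wgrad :: "(real^3) set \<Rightarrow> scalar_field \<Rightarrow> vector_field" where
  "wgrad \<Omega> v = (SOME w. has_weak_grad \<Omega> v w)"

definition wcurl :: "(real^3) set \<Rightarrow> vector_field \<Rightarrow> vector_field" where
  "wcurl \<Omega> v = (SOME w. has_weak_curl \<Omega> v w)"

definition wdiv :: "(real^3) set \<Rightarrow> vector_field \<Rightarrow> scalar_field" where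
  "wdiv \<Omega> v = (SOME w. has_weak_div \<Omega> v w)"

text \<open>Boundary traces are taken in the weak sense: they are the functionals that Green's
  formula assigns to fields smooth up to the boundary (restrictions to \<open>\<Omega>\<close> of smooth fields on
  the whole space).  For smooth \<open>v\<close> they are the boundary integrals of \<open>v (\<phi> \<bullet> n)\<close>,
  \<open>(v \<times> n) \<bullet> \<phi>\<close> and \<open>(v \<bullet> n) \<phi>\<close>, where \<open>n\<close> is the unit outer normal.\<close>

definition full_trace :: "(real^3) set \<Rightarrow> scalar_field \<Rightarrow> vector_field \<Rightarrow> real" where
  "full_trace \<Omega> v \<phi> = ip \<Omega> v (cdiv \<phi>) + ip \<Omega> (wgrad \<Omega> v) \<phi>"

definition tangential_trace :: "(real^3) set \<Rightarrow> vector_field \<Rightarrow> vector_field \<Rightarrow> real" where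
  "tangential_trace \<Omega> v \<phi> = ip \<Omega> v (ccurl \<phi>) - ip \<Omega> (wcurl \<Omega> v) \<phi>"

definition normal_trace :: "(real^3) set \<Rightarrow> vector_field \<Rightarrow> scalar_field \<Rightarrow> real" where
  "normal_trace \<Omega> v \<phi> = ip \<Omega> v (cgrad \<phi>) + ip \<Omega> (wdiv \<Omega> v) \<phi>"

definition H0_grad :: "(real^3) set \<Rightarrow> scalar_field set" where
  "H0_grad \<Omega> = {v \<in> H_grad \<Omega>. \<forall>\<phi>. smooth_vector \<phi> \<longrightarrow> full_trace \<Omega> v \<phi> = 0}"

definition H0_curl :: "(real^3) set \<Rightarrow> vector_field set" where
  "H0_curl \<Omega> = {v \<in> H_curl \<Omega>. \<forall>\<phi>. smooth_vector \<phi> \<longrightarrow> tangential_trace \<Omega> v \<phi> = 0}"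

definition H0_div :: "(real^3) set \<Rightarrow> vector_field set" where
  "H0_div \<Omega> = {v \<in> H_div \<Omega>. \<forall>\<phi>. smooth_scalar \<phi> \<longrightarrow> normal_trace \<Omega> v \<phi> = 0}"

definition mesh :: "(real^3) set \<Rightarrow> (real^3) set set \<Rightarrow> bool" where
  "mesh \<Omega> T \<longleftrightarrow> finite T \<and> disjoint T \<and>
     (\<forall>K\<in>T. open K \<and> K \<noteq> {} \<and> K \<subseteq> \<Omega>) \<and> negligible (\<Omega> - \<Union>T)"

definition piecewise_polynomial ::
    "(real^3) set set \<Rightarrow> (real^3 \<Rightarrow> 'b::euclidean_space) \<Rightarrow> bool" where
  "piecewise_polynomial T v \<longleftrightarrow> (\<forall>K\<in>T. \<exists>p. polynomial_function p \<and> aeq K v p)"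

text \<open>A subspace of \<open>L\<^sup>2(\<Omega>)\<close> is encoded by the set of all representatives of its elements,
  whence the closure under \<open>aeq \<Omega>\<close>.\<close>

definition L2_subspace :: "(real^3) set \<Rightarrow> (real^3 \<Rightarrow> 'b::euclidean_space) set \<Rightarrow> bool" where
  "L2_subspace \<Omega> V \<longleftrightarrow> V \<subseteq> L2 \<Omega> \<and> (\<lambda>x. 0) \<in> V \<and>
     (\<forall>f\<in>V. \<forall>g\<in>V. (\<lambda>x. f x + g x) \<in> V) \<and>
     (\<forall>a. \<forall>f\<in>V. (\<lambda>x. a *\<^sub>R f x) \<in> V) \<and>
     (\<forall>f\<in>V. \<forall>g\<in>L2 \<Omega>. aeq \<Omega> f g \<longrightarrow> g \<in> V)"

definition fe_space ::
    "(real^3) set \<Rightarrow> (real^3) set set \<Rightarrow> (real^3 \<Rightarrow> 'b::euclidean_space) set \<Rightarrow> bool" where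
  "fe_space \<Omega> T V \<longleftrightarrow> L2_subspace \<Omega> V \<and>
     (\<exists>S. finite S \<and> S \<subseteq> V \<and>
        (\<forall>v\<in>V. \<exists>a. aeq \<Omega> v (\<lambda>x. \<Sum>s\<in>S. a s *\<^sub>R s x))) \<and>
     (\<forall>v\<in>V. piecewise_polynomial T v)"

definition discrete_de_rham ::
    "(real^3) set \<Rightarrow> (real^3) set set \<Rightarrow>
     scalar_field set \<Rightarrow> vector_field set \<Rightarrow> vector_field set \<Rightarrow> scalar_field set \<Rightarrow> bool" where
  "discrete_de_rham \<Omega> T Vg Vc Vd W \<longleftrightarrow>
     fe_space \<Omega> T Vg \<and> Vg \<subseteq> H0_grad \<Omega> \<and>
     fe_space \<Omega> T Vc \<and> Vc \<subseteq> H0_curl \<Omega> \<and>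
     fe_space \<Omega> T Vd \<and> Vd \<subseteq> H0_div \<Omega> \<and>
     fe_space \<Omega> T W \<and> W \<subseteq> L2_0 \<Omega> \<and>
     wgrad \<Omega> ` Vg \<subseteq> Vc \<and> wcurl \<Omega> ` Vc \<subseteq> Vd \<and> wdiv \<Omega> ` Vd \<subseteq> W \<and>
     (\<forall>q\<in>Vg. aeq \<Omega> (wgrad \<Omega> q) (\<lambda>x. 0) \<longrightarrow> aeq \<Omega> q (\<lambda>x. 0)) \<and>
     (\<forall>v\<in>Vc. aeq \<Omega> (wcurl \<Omega> v) (\<lambda>x. 0) \<longleftrightarrow> (\<exists>q\<in>Vg. aeq \<Omega> v (wgrad \<Omega> q))) \<and>
     (\<forall>v\<in>Vd. aeq \<Omega> (wdiv \<Omega> v) (\<lambda>x. 0) \<longleftrightarrow> (\<exists>z\<in>Vc. aeq \<Omega> v (wcurl \<Omega> z))) \<and>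
     (\<forall>q\<in>W. \<exists>v\<in>Vd. aeq \<Omega> q (wdiv \<Omega> v))"

definition Dt :: "real \<Rightarrow> (nat \<Rightarrow> vector_field) \<Rightarrow> nat \<Rightarrow> vector_field" where
  "Dt \<Delta>t u n = (\<lambda>x. (u (Suc n) x - u n x) /\<^sub>R \<Delta>t)"

definition mid :: "(nat \<Rightarrow> vector_field) \<Rightarrow> nat \<Rightarrow> vector_field" where
  "mid u n = (\<lambda>x. (u (Suc n) x + u n x) /\<^sub>R 2)"

definition Dt_integral ::
    "(real^3) set \<Rightarrow> real \<Rightarrow> (nat \<Rightarrow> vector_field) \<Rightarrow> (nat \<Rightarrow> vector_field) \<Rightarrow> nat \<Rightarrow> real" where
  "Dt_integral \<Omega> \<Delta>t a b n = (ip \<Omega> (a (Suc n)) (b (Suc n)) - ip \<Omega> (a n) (b n)) / \<Delta>t"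

definition midtime :: "real \<Rightarrow> nat \<Rightarrow> real" where
  "midtime \<Delta>t n = (real n + 1/2) * \<Delta>t"

text \<open>The unknowns \<open>\<omega>\<close>, \<open>j\<close>, \<open>E\<close>, \<open>H\<close>, \<open>P\<close> at index \<open>n\<close> live at time level \<open>n + 1/2\<close>.
  Reynolds numbers are extended reals, so that \<open>inverse \<infinity> = 0\<close>.\<close>

definition mhd_solution ::
    "(real^3) set \<Rightarrow> scalar_field set \<Rightarrow> vector_field set \<Rightarrow> vector_field set \<Rightarrow>
     real \<Rightarrow> real \<Rightarrow> ereal \<Rightarrow> ereal \<Rightarrow> (real \<Rightarrow> vector_field) \<Rightarrow>
     (nat \<Rightarrow> vector_field) \<Rightarrow> (nat \<Rightarrow> vector_field) \<Rightarrow> (nat \<Rightarrow> vector_field) \<Rightarrow>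
     (nat \<Rightarrow> vector_field) \<Rightarrow> (nat \<Rightarrow> vector_field) \<Rightarrow> (nat \<Rightarrow> vector_field) \<Rightarrow>
     (nat \<Rightarrow> scalar_field) \<Rightarrow> bool" where
  "mhd_solution \<Omega> Vg Vc Vd \<Delta>t c R_e R_m f u B \<omega> j E H P \<longleftrightarrow>
     (\<forall>n. u n \<in> Vc \<and> B n \<in> Vd \<and> \<omega> n \<in> Vc \<and> j n \<in> Vc \<and> E n \<in> Vc \<and> H n \<in> Vc \<and> P n \<in> Vg) \<and>
     (\<forall>n.
       (\<forall>v\<in>Vc. ip \<Omega> (Dt \<Delta>t u n) v
            - ip \<Omega> (\<lambda>x. cross3 (mid u n x) (\<omega> n x)) v
            + real_of_ereal (inverse R_e) * ip \<Omega> (wcurl \<Omega> (mid u n)) (wcurl \<Omega> v)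
            + ip \<Omega> (wgrad \<Omega> (P n)) v
            - c * ip \<Omega> (\<lambda>x. cross3 (j n x) (H n x)) v
            = ip \<Omega> (f (midtime \<Delta>t n)) v) \<and>
       (\<forall>C\<in>Vd. ip \<Omega> (Dt \<Delta>t B n) C + ip \<Omega> (wcurl \<Omega> (E n)) C = 0) \<and>
       (\<forall>G\<in>Vc. ip \<Omega> (\<lambda>x. real_of_ereal (inverse R_m) *\<^sub>R j n x
                          - (E n x + cross3 (mid u n x) (H n x))) G = 0) \<and>
       (\<forall>\<mu>\<in>Vc. ip \<Omega> (\<omega> n) \<mu> - ip \<Omega> (wcurl \<Omega> (mid u n)) \<mu> = 0) \<and>
       (\<forall>k\<in>Vc. ip \<Omega> (j n) k - ip \<Omega> (mid B n) (wcurl \<Omega> k) = 0) \<and>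
       (\<forall>F\<in>Vc. ip \<Omega> (mid B n) F - ip \<Omega> (H n) F = 0) \<and>
       (\<forall>Q\<in>Vg. ip \<Omega> (mid u n) (wgrad \<Omega> Q) = 0))"

end

theory Submission
  imports Defs
begin

text \<open>
  Everything rests on one discrete Green formula, lemma \<open>wcurl_symmetric\<close>: the curl is symmetric on
  the finite element space, \<open>(v, curl w) = (curl v, w)\<close>. Given this, the theorem is the classical
  energy-type computation carried out at the midpoint. For the magnetic helicity, symmetry of the
  curl turns the discrete product rule into \<open>2 (D\<^sub>t B, A)\<close>; Faraday's law and symmetry give
  \<open>- 2 (E, B)\<close>; since \<open>H\<close> is the projection of \<open>B\<close>, this is \<open>- 2 (E, H)\<close>, and the ideal Ohm law
  \<open>E = - u \<times> H\<close> (tested with \<open>H\<close>) makes it vanish. For the cross helicity, \<open>(D\<^sub>t B, u)\<close> becomes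
  \<open>- (curl u, E) = - (\<omega>, E) = - (u \<times> \<omega>, H)\<close>, while the momentum equation tested with \<open>H\<close> gives
  \<open>(B, D\<^sub>t u) = (u \<times> \<omega>, H)\<close>: the Lorentz force is orthogonal to \<open>H\<close>, the source is orthogonal to
  \<open>H\<close> by hypothesis, and the pressure gradient drops out since
  \<open>(H, grad P) = (B, grad P) = (curl A, grad P) = (A, curl grad P) = 0\<close>.

  The Green formula needs an argument, because the boundary condition defining \<open>H0_curl\<close> only
  allows integration by parts against fields that are smooth on the whole space. Neither factor need be
  smooth, so one of them has to be regularised by convolution. For an approximate identity \<open>k\<close>,
  the field \<open>y \<mapsto> k (x - y) e\<close> is an admissible test field for each fixed \<open>x\<close> and \<open>e\<close>, and
  Fubini's theorem yields
    \<open>\<integral>\<integral> k (x - y) v(x) \<bullet> curl w(y) = \<integral>\<integral> k (x - y) curl v(x) \<bullet> w(y)\<close>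
  (lemma \<open>weak_curl_kernel_exchange\<close>): both sides are the integral of \<open>v(x) \<bullet> (\<nabla>k(x - y) \<times> w(y))\<close>.
  Since the test fields need not have compact support,
  \<open>k\<close> may be taken to be the Landau kernel, a power of \<open>1 - |z|\<^sup>2 / R\<^sup>2\<close> with \<open>R\<close> above the
  diameter of the domain; it is a polynomial there, so smoothness is immediate. Finally, a
  piecewise polynomial field is almost everywhere equal to a bounded field that is continuous at
  almost every point, so that the Landau means converge almost everywhere and dominated convergence
  identifies the limits of the two double integrals
  (lemma \<open>landau_double_integral_tendsto\<close>).
\<close>

section \<open>Polynomial test fields\<close>

lemma pd_has_derivative:
  assumes "(f has_derivative f') (at x)"
  shows "pd i f x = f' (axis i 1)"
  using frechet_derivative_at[OF assms] by (simp add: pd_def)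

lemma pd_real_polynomial_function:
  assumes "real_polynomial_function p"
  shows "real_polynomial_function (pd i p)"
  using assms
proof (induction p rule: real_polynomial_function.induct)
  case (linear f)
  then have "pd i f = (\<lambda>x. f (axis i 1))"
    by (intro ext pd_has_derivative bounded_linear_imp_has_derivative)
  then show ?case by (simp add: real_polynomial_function.intros(2))
next
  case (const c)
  have "pd i (\<lambda>x. c) = (\<lambda>x. 0)"
    by (intro ext, subst pd_has_derivative[OF has_derivative_const]) simp
  then show ?case by (simp add: real_polynomial_function.intros(2))
next
  case (add f g)
  have "pd i (\<lambda>x. f x + g x) x = pd i f x + pd i g x" for x
    using add.hyps by (subst pd_has_derivative[OF has_derivative_add])
      (auto simp: pd_def frechet_derivative_works[symmetric]
        intro: differentiable_at_real_polynomial_function)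
  then show ?case using add.IH by (auto simp: fun_eq_iff[symmetric] intro: real_polynomial_function.intros(3))
next
  case (mult f g)
  have "pd i (\<lambda>x. f x * g x) x = f x * pd i g x + pd i f x * g x" for x
    using mult.hyps by (subst pd_has_derivative[OF has_derivative_mult])
      (auto simp: pd_def frechet_derivative_works[symmetric]
        intro: differentiable_at_real_polynomial_function)
  then have "pd i (\<lambda>x. f x * g x) = (\<lambda>x. f x * pd i g x + pd i f x * g x)" by auto
  then show ?case using mult
    by (auto intro: real_polynomial_function.intros(3) real_polynomial_function.intros(4))
qed

lemma smooth_scalar_real_polynomial_function:
  assumes "real_polynomial_function p"
  shows "smooth_scalar p"
  unfolding smooth_scalar_def
proof
  fix k show "Ck k p"
    using assms
  proof (induction k arbitrary: p)
    case 0
    then show ?case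
      by (simp add: continuous_on_polymonial_function real_polynomial_function_eq)
  next
    case (Suc k)
    then show ?case
      by (simp add: differentiable_at_real_polynomial_function pd_real_polynomial_function)
  qed
qed

lemma smooth_vector_kernel_slice:
  assumes "real_polynomial_function \<kappa>"
  shows "smooth_vector (\<lambda>y. \<kappa> (s *\<^sub>R y + a) *\<^sub>R e)"
  unfolding smooth_vector_def
proof
  fix i
  have "polynomial_function (\<lambda>y::real^3. s *\<^sub>R y + a)"
    by (intro polynomial_function_add polynomial_function_cmul polynomial_function_const
        polynomial_function_id)
  from real_polynomial_function_compose[OF this assms]
  have "real_polynomial_function (\<lambda>y. \<kappa> (s *\<^sub>R y + a) * e $ i)"
    by (intro real_polynomial_function.intros(4) real_polynomial_function.intros(2)) (simp add: o_def)
  then show "smooth_scalar (\<lambda>y. (\<kappa> (s *\<^sub>R y + a) *\<^sub>R e) $ i)"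
    by (simp add: smooth_scalar_real_polynomial_function)
qed

lemma pd_kernel_slice:
  assumes "real_polynomial_function \<kappa>"
  shows "pd i (\<lambda>y. \<kappa> (s *\<^sub>R y + a) * b) y = s * pd i \<kappa> (s *\<^sub>R y + a) * b"
proof -
  let ?z = "s *\<^sub>R y + a"
  have d: "(\<kappa> has_derivative frechet_derivative \<kappa> (at ?z)) (at ?z)"
    using assms differentiable_at_real_polynomial_function frechet_derivative_works by blast
  have "((\<lambda>y. s *\<^sub>R y + a) has_derivative (\<lambda>h. s *\<^sub>R h)) (at y)"
    by (auto intro!: derivative_eq_intros)
  from has_derivative_compose[OF this d]
  have "((\<lambda>y. \<kappa> (s *\<^sub>R y + a) * b) has_derivative
      (\<lambda>h. frechet_derivative \<kappa> (at ?z) (s *\<^sub>R h) * b)) (at y)"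
    by (rule has_derivative_mult_left)
  from pd_has_derivative[OF this] show ?thesis
    using linear_cmul[OF has_derivative_linear[OF d], of s "axis i 1"] by (simp add: pd_def)
qed

text \<open>Only the signs \<open>s = -1\<close> and \<open>s = 1\<close> occur below, for the kernel \<open>\<kappa> (x - y)\<close> as a function of its
  second and of its first argument.\<close>

lemma ccurl_kernel_slice:
  assumes "real_polynomial_function \<kappa>"
  shows "ccurl (\<lambda>y. \<kappa> (s *\<^sub>R y + a) *\<^sub>R e) y = s *\<^sub>R cross3 (cgrad \<kappa> (s *\<^sub>R y + a)) e"
  using pd_kernel_slice[OF assms]
  by (simp add: ccurl_def cross3_def cgrad_def vec_eq_iff forall_3 algebra_simps)

lemma continuous_on_cgrad_real_polynomial:
  assumes "real_polynomial_function p"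
  shows "continuous_on S (cgrad p)"
proof -
  have "continuous_on S (pd i p)" for i
    using pd_real_polynomial_function[OF assms]
    by (simp add: continuous_on_polymonial_function real_polynomial_function_eq)
  then have "continuous_on S (\<lambda>x. \<chi> i. pd i p x)"
    by (intro continuous_intros)
  then show ?thesis by (simp add: cgrad_def[abs_def])
qed

lemma smooth_scalar_continuous:
  assumes "smooth_scalar f"
  shows "continuous_on UNIV f" "continuous_on UNIV (pd i f)"
proof -
  show "continuous_on UNIV f"
    using assms Ck.simps(1) unfolding smooth_scalar_def by blast
  have "Ck (Suc 0) f"
    using assms unfolding smooth_scalar_def by blast
  then show "continuous_on UNIV (pd i f)"
    by simp
qed

text \<open>Continuity is used for the measurability of test fields and of their curls.\<close>

lemma smooth_vector_continuous:
  assumes "smooth_vector \<phi>"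
  shows "continuous_on UNIV \<phi>" "continuous_on UNIV (ccurl \<phi>)"
proof -
  have s: "smooth_scalar (\<lambda>x. \<phi> x $ i)" for i
    using assms by (simp add: smooth_vector_def)
  have "continuous_on UNIV (\<lambda>x. \<chi> i. \<phi> x $ i)"
    by (intro continuous_intros smooth_scalar_continuous s)
  then show "continuous_on UNIV \<phi>" by simp
  have "continuous_on UNIV (\<lambda>x. \<chi> i. ccurl \<phi> x $ i)"
  proof (rule continuous_on_vec_lambda)
    fix i :: 3
    show "continuous_on UNIV (\<lambda>x. ccurl \<phi> x $ i)"
      using exhaust_3[of i] smooth_scalar_continuous(2)[OF s]
      by (auto simp: ccurl_def vector_3 intro!: continuous_on_diff)
  qed
  then show "continuous_on UNIV (ccurl \<phi>)" by simp
qed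

section \<open>The Landau kernel\<close>

text \<open>The cut-off to the ball makes the kernel nonnegative and integrable on the whole space, so that it can
  be normalised there; inside the ball it is a polynomial.\<close>

definition landau :: "real \<Rightarrow> nat \<Rightarrow> 'a::euclidean_space \<Rightarrow> real" where
  "landau R n z = indicator (ball 0 R) z * (1 - (norm z / R)\<^sup>2) ^ n"

definition landau_mass :: "'a::euclidean_space itself \<Rightarrow> real \<Rightarrow> nat \<Rightarrow> real" where
  "landau_mass _ R n = integral\<^sup>L lborel (landau R n :: 'a \<Rightarrow> real)"

lemma norm_ratio_square_le:
  fixes z :: "'a::real_normed_vector"
  assumes "norm z \<le> r"
  shows "(norm z / R)\<^sup>2 \<le> (r / R)\<^sup>2"
  using assms by (simp add: power_divide divide_right_mono power_mono)

lemma landau_nonneg: "0 \<le> landau R n z"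
proof (cases "z \<in> ball 0 R")
  case True
  then have "(norm z / R)\<^sup>2 \<le> (R / R)\<^sup>2"
    by (intro norm_ratio_square_le) auto
  also have "\<dots> \<le> 1"
    by (cases "R = 0") auto
  finally show ?thesis
    by (simp add: landau_def)
qed (simp add: landau_def)

lemma landau_le_indicator: "landau R n z \<le> indicator (ball 0 R) z"
proof -
  have "(1 - (norm z / R)\<^sup>2) ^ n \<le> 1" if "z \<in> ball 0 R"
  proof (rule power_le_one)
    have "(norm z / R)\<^sup>2 \<le> (R / R)\<^sup>2"
      using that by (intro norm_ratio_square_le) auto
    also have "\<dots> \<le> 1"
      by (cases "R = 0") auto
    finally show "0 \<le> 1 - (norm z / R)\<^sup>2" by simp
  qed simp
  then show ?thesis
    by (auto simp: landau_def split: split_indicator)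
qed

lemma borel_measurable_landau [measurable]:
  "(landau R n :: 'a::euclidean_space \<Rightarrow> real) \<in> borel_measurable borel"
proof -
  have [measurable]: "ball (0::'a) R \<in> sets borel"
    by simp
  show ?thesis
    unfolding landau_def[abs_def] by measurable
qed

lemma integrable_indicator_ball:
  "integrable lborel (indicator (ball (x::'a::euclidean_space) r) :: 'a \<Rightarrow> real)"
  by (rule integrable_real_indicator) (use emeasure_lborel_ball_finite[of x r] in \<open>auto simp: top.not_eq_extremum\<close>)

lemma integrable_landau: "integrable lborel (landau R n :: 'a::euclidean_space \<Rightarrow> real)"
  by (rule Bochner_Integration.integrable_bound[OF integrable_indicator_ball[of 0 R]])
     (auto simp: landau_nonneg landau_le_indicator)

text \<open>The mass decays no faster than the value of the kernel at radius \<open>r\<close>, for arbitrarily small \<open>r\<close>. This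
  is what makes the tails negligible after normalisation.\<close>

lemma landau_mass_ge:
  assumes "0 < r" "r < R"
  shows "(1 - (r / R)\<^sup>2) ^ n * measure lborel (ball (0::'a::euclidean_space) r)
         \<le> landau_mass TYPE('a) R n"
proof -
  have "(1 - (r / R)\<^sup>2) ^ n * measure lborel (ball (0::'a) r)
        = integral\<^sup>L lborel (\<lambda>z::'a. (1 - (r / R)\<^sup>2) ^ n * indicator (ball 0 r) z)"
    by simp
  also have "\<dots> \<le> landau_mass TYPE('a) R n"
    unfolding landau_mass_def
  proof (rule integral_mono)
    show "integrable lborel (\<lambda>z::'a. (1 - (r / R)\<^sup>2) ^ n * indicator (ball 0 r) z)"
      by (intro integrable_mult_right integrable_indicator_ball)
    show "integrable lborel (landau R n :: 'a \<Rightarrow> real)"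
      by (rule integrable_landau)
    fix z :: 'a
    show "(1 - (r / R)\<^sup>2) ^ n * indicator (ball 0 r) z \<le> landau R n z"
    proof (cases "z \<in> ball 0 r")
      case True
      have "(r / R)\<^sup>2 \<le> 1"
        using assms by (simp add: power_le_one)
      moreover have "(norm z / R)\<^sup>2 \<le> (r / R)\<^sup>2"
        using True by (intro norm_ratio_square_le) auto
      ultimately have "(1 - (r / R)\<^sup>2) ^ n \<le> (1 - (norm z / R)\<^sup>2) ^ n"
        by (intro power_mono) auto
      then show ?thesis
        using True assms by (auto simp: landau_def)
    qed (simp add: landau_nonneg)
  qed
  finally show ?thesis .
qed

lemma landau_mass_pos:
  assumes "0 < R"
  shows "0 < landau_mass TYPE('a::euclidean_space) R n"
proof -
  have "((1/2)::real)\<^sup>2 < 1"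
    by (simp add: power2_eq_square)
  then have "0 < (1 - ((R/2) / R)\<^sup>2) ^ n * measure lborel (ball (0::'a) (R/2))"
    using assms content_ball_pos[of "R/2" "0::'a"] by (intro mult_pos_pos zero_less_power) auto
  then show ?thesis
    using landau_mass_ge[of "R/2" R n, where 'a='a] assms by linarith
qed

definition landau_kernel :: "real \<Rightarrow> nat \<Rightarrow> 'a::euclidean_space \<Rightarrow> real" where
  "landau_kernel R n z = landau R n z / landau_mass TYPE('a) R n"

lemma borel_measurable_landau_kernel [measurable]: "landau_kernel R n \<in> borel_measurable borel"
  unfolding landau_kernel_def by measurable

lemma landau_kernel_nonneg: "0 < R \<Longrightarrow> 0 \<le> landau_kernel R n z"
  by (simp add: landau_kernel_def landau_nonneg less_imp_le[OF landau_mass_pos])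

lemma landau_kernel_minus: "landau_kernel R n (- z) = landau_kernel R n z"
  by (simp add: landau_kernel_def landau_def indicator_def)

lemma has_bochner_integral_landau_kernel:
  fixes x :: "'a::euclidean_space"
  assumes "0 < R"
  shows "has_bochner_integral lebesgue (\<lambda>y. landau_kernel R n (x - y)) 1"
proof -
  have "has_bochner_integral lborel (\<lambda>z::'a. landau R n z / landau_mass TYPE('a) R n)
      (landau_mass TYPE('a) R n / landau_mass TYPE('a) R n)"
    unfolding has_bochner_integral_iff landau_mass_def using integrable_landau by auto
  then have "has_bochner_integral lborel (landau_kernel R n :: 'a \<Rightarrow> real) 1"
    using landau_mass_pos[OF assms, of n, where 'a='a] by (simp add: landau_kernel_def[abs_def])
  then have "has_bochner_integral (distr lborel borel ((+) (- x))) (landau_kernel R n :: 'a \<Rightarrow> real) 1"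
    by (simp add: lborel_distr_plus)
  then have "has_bochner_integral lborel (\<lambda>y. landau_kernel R n (- x + y)) 1"
    unfolding has_bochner_integral_iff
    by (subst (asm) integrable_distr_eq, simp, simp, subst (asm) integral_distr) auto
  moreover have "landau_kernel R n (- x + y) = landau_kernel R n (x - y)" for y
    using landau_kernel_minus[of R n "x - y"] by simp
  ultimately have "has_bochner_integral lborel (\<lambda>y. landau_kernel R n (x - y)) 1"
    by simp
  then show ?thesis
    by (auto simp: has_bochner_integral_iff integrable_completion integral_completion)
qed

text \<open>Outside radius \<open>\<delta>\<close> the kernel is at most its value there, whereas its mass is at least a constant times its value
  at radius \<open>\<delta>/2\<close>. The quotient of the two is a geometric sequence with ratio below one.\<close>

lemma landau_kernel_tail_le:
  fixes z :: "'a::euclidean_space"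
  assumes "0 < \<delta>" "\<delta> < R" "\<delta> \<le> norm z"
  shows "landau_kernel R n z \<le>
    ((1 - (\<delta>/R)\<^sup>2) / (1 - (\<delta>/2/R)\<^sup>2)) ^ n / measure lborel (ball (0::'a) (\<delta>/2))
      * indicator (ball 0 R) z"
proof (cases "z \<in> ball 0 R")
  case True
  have R: "0 < R" using assms by simp
  have p: "0 < 1 - (\<delta>/2/R)\<^sup>2"
  proof -
    have "(\<delta>/2/R)\<^sup>2 < 1\<^sup>2"
      using assms by (intro power_strict_mono) (auto simp: divide_simps)
    then show ?thesis by simp
  qed
  have W: "0 < measure lborel (ball (0::'a) (\<delta>/2))"
    using content_ball_pos[of "\<delta>/2" "0::'a"] assms by simp
  have "(norm z / R)\<^sup>2 \<le> 1"
    using True R by (auto intro!: power_le_one simp: divide_simps)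
  moreover have "(\<delta> / R)\<^sup>2 \<le> (norm z / R)\<^sup>2"
    using assms by (intro power_mono) (auto simp: divide_simps)
  ultimately have "landau R n z \<le> (1 - (\<delta>/R)\<^sup>2) ^ n"
    using True by (auto simp: landau_def intro!: power_mono)
  then have "landau_kernel R n z \<le> (1 - (\<delta>/R)\<^sup>2) ^ n /
      ((1 - (\<delta>/2/R)\<^sup>2) ^ n * measure lborel (ball (0::'a) (\<delta>/2)))"
    unfolding landau_kernel_def using p W assms landau_mass_ge[of "\<delta>/2" R n, where 'a='a]
    by (intro frac_le) (auto intro: order_trans[OF landau_nonneg])
  then show ?thesis
    using True by (simp add: power_divide)
qed (simp add: landau_kernel_def landau_def)

lemma landau_kernel_tail_tendsto_0:
  fixes \<delta> R :: real
  assumes "0 < \<delta>" "\<delta> < R"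
  shows "(\<lambda>n. ((1 - (\<delta>/R)\<^sup>2) / (1 - (\<delta>/2/R)\<^sup>2)) ^ n) \<longlonglongrightarrow> 0"
proof (rule LIMSEQ_power_zero)
  have "(\<delta>/R)\<^sup>2 < 1\<^sup>2"
    using assms by (intro power_strict_mono) (auto simp: divide_simps)
  moreover have "(\<delta>/2/R)\<^sup>2 < (\<delta>/R)\<^sup>2"
    using assms by (intro power_strict_mono) (auto simp: divide_simps)
  moreover have "0 \<le> (1 - a) / (1 - b) \<and> (1 - a) / (1 - b) < 1" if "a < 1\<^sup>2" "b < a" for a b :: real
    using that by (simp add: divide_simps)
  ultimately have "0 \<le> (1 - (\<delta>/R)\<^sup>2) / (1 - (\<delta>/2/R)\<^sup>2)"
      "(1 - (\<delta>/R)\<^sup>2) / (1 - (\<delta>/2/R)\<^sup>2) < 1"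
    by blast+
  then show "norm ((1 - (\<delta>/R)\<^sup>2) / (1 - (\<delta>/2/R)\<^sup>2)) < 1"
    by (metis abs_of_nonneg real_norm_def)
qed

lemma integrable_landau_kernel_times_bounded:
  fixes g :: "'a::euclidean_space \<Rightarrow> 'b::euclidean_space"
  assumes "0 < R" and [measurable]: "g \<in> borel_measurable lebesgue" and "\<And>y. norm (g y) \<le> M"
  shows "integrable lebesgue (\<lambda>y. landau_kernel R n (x - y) *\<^sub>R g y)"
proof (rule Bochner_Integration.integrable_bound)
  show "integrable lebesgue (\<lambda>y. M * landau_kernel R n (x - y))"
    using has_bochner_integral_landau_kernel[OF assms(1)]
    by (intro integrable_mult_right) (auto simp: has_bochner_integral_iff)
  have "(\<lambda>y. landau_kernel R n (x - y)) \<in> borel_measurable lborel"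
    by measurable
  then have [measurable]: "(\<lambda>y. landau_kernel R n (x - y)) \<in> borel_measurable lebesgue"
    by (rule measurable_completion)
  show "(\<lambda>y. landau_kernel R n (x - y) *\<^sub>R g y) \<in> borel_measurable lebesgue"
    by measurable
  have "0 \<le> M" using assms(3) norm_ge_zero order_trans by blast
  then show "AE y in lebesgue. norm (landau_kernel R n (x - y) *\<^sub>R g y)
      \<le> norm (M * landau_kernel R n (x - y))"
    using assms
    by (auto simp: landau_kernel_nonneg abs_mult mult.commute intro!: mult_right_mono AE_I2)
qed

lemma norm_landau_mean_le:
  fixes g :: "'a::euclidean_space \<Rightarrow> 'b::euclidean_space"
  assumes "0 < R" and "g \<in> borel_measurable lebesgue" and "\<And>y. norm (g y) \<le> M"
  shows "norm (\<integral>y. landau_kernel R n (x - y) *\<^sub>R g y \<partial>lebesgue) \<le> M"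
proof -
  have I: "has_bochner_integral lebesgue (\<lambda>y. M * landau_kernel R n (x - y)) (M * 1)"
    using has_bochner_integral_landau_kernel[OF assms(1)]
    by (intro has_bochner_integral_mult_right) auto
  have "norm (\<integral>y. landau_kernel R n (x - y) *\<^sub>R g y \<partial>lebesgue)
      \<le> (\<integral>y. norm (landau_kernel R n (x - y) *\<^sub>R g y) \<partial>lebesgue)"
    by (rule integral_norm_bound)
  also have "\<dots> \<le> (\<integral>y. M * landau_kernel R n (x - y) \<partial>lebesgue)"
  proof (rule integral_mono)
    show "integrable lebesgue (\<lambda>y. norm (landau_kernel R n (x - y) *\<^sub>R g y))"
      by (rule integrable_norm, rule integrable_landau_kernel_times_bounded) (rule assms)+
    show "integrable lebesgue (\<lambda>y. M * landau_kernel R n (x - y))"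
      using I by (simp add: has_bochner_integral_iff)
    show "norm (landau_kernel R n (x - y) *\<^sub>R g y) \<le> M * landau_kernel R n (x - y)" for y
      using mult_right_mono[OF assms(3) landau_kernel_nonneg[OF assms(1)], of y n "x - y"]
      by (simp add: landau_kernel_nonneg[OF assms(1)] mult.commute)
  qed
  also have "\<dots> = M"
    using I by (simp add: has_bochner_integral_iff)
  finally show ?thesis .
qed

text \<open>Boundedness and continuity at the single point \<open>x\<close> suffice: the kernel has mass one, its
  part near \<open>x\<close> sees only values close to \<open>g x\<close>, and its part away from \<open>x\<close> tends to zero uniformly.\<close>

lemma landau_mean_tendsto:
  fixes g :: "'a::euclidean_space \<Rightarrow> 'b::euclidean_space"
  assumes R: "0 < R" and g [measurable]: "g \<in> borel_measurable lebesgue"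
    and M: "\<And>y. norm (g y) \<le> M" and cont: "isCont g x"
  shows "(\<lambda>n. \<integral>y. landau_kernel R n (x - y) *\<^sub>R g y \<partial>lebesgue) \<longlonglongrightarrow> g x"
proof (rule LIMSEQ_I)
  fix e :: real assume e: "0 < e"
  have M0: "0 \<le> M" using M norm_ge_zero order_trans by blast
  obtain d where d: "0 < d" "\<And>y. dist y x < d \<Longrightarrow> dist (g y) (g x) < e / 2"
    using cont e unfolding continuous_at_eps_delta by (metis half_gt_zero)
  define \<delta> where "\<delta> = min d (R / 2)"
  have \<delta>: "0 < \<delta>" "\<delta> < R" "\<And>y. norm (x - y) < \<delta> \<Longrightarrow> norm (g y - g x) \<le> e / 2"
    using d R unfolding \<delta>_def by (auto simp: dist_norm norm_minus_commute intro: less_imp_le)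
  define t where "t n = ((1 - (\<delta>/R)\<^sup>2) / (1 - (\<delta>/2/R)\<^sup>2)) ^ n / measure lborel (ball (0::'a) (\<delta>/2))"
    for n
  define V where "V = measure lborel (ball x R)"
  have "(\<lambda>n. 2 * M * V * t n) \<longlonglongrightarrow> 2 * M * V * (0 / measure lborel (ball (0::'a) (\<delta>/2)))"
    unfolding t_def using content_ball_pos[of "\<delta>/2" "0::'a"] \<delta>
    by (intro tendsto_intros landau_kernel_tail_tendsto_0) auto
  then have "(\<lambda>n. 2 * M * V * t n) \<longlonglongrightarrow> 0" by simp
  then have small: "\<forall>\<^sub>F n in sequentially. 2 * M * V * t n < e / 2"
    using e by (intro order_tendstoD) auto
  have bound: "norm ((\<integral>y. landau_kernel R n (x - y) *\<^sub>R g y \<partial>lebesgue) - g x)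
      \<le> e / 2 + 2 * M * V * t n" for n
  proof -
    note K = has_bochner_integral_landau_kernel[OF R, of n x]
    have h [measurable]: "(\<lambda>y. g y - g x) \<in> borel_measurable lebesgue"
      by measurable
    have hM: "norm (g y - g x) \<le> 2 * M" for y
      using norm_triangle_ineq4[of "g y" "g x"] M[of y] M[of x] by linarith
    have V: "has_bochner_integral lebesgue (indicator (ball x R) :: 'a \<Rightarrow> real) V"
      unfolding V_def using integrable_indicator_ball[of x R]
      by (auto simp: has_bochner_integral_iff integrable_completion integral_completion)
    have I: "has_bochner_integral lebesgue
        (\<lambda>y. e / 2 * landau_kernel R n (x - y) + 2 * M * t n * indicator (ball x R) y)
        (e / 2 * 1 + 2 * M * t n * V)"
      by (intro has_bochner_integral_add has_bochner_integral_mult_right K V)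
    have "(\<integral>y. landau_kernel R n (x - y) *\<^sub>R (g y - g x) \<partial>lebesgue)
        = (\<integral>y. landau_kernel R n (x - y) *\<^sub>R g y \<partial>lebesgue)
          - (\<integral>y. landau_kernel R n (x - y) *\<^sub>R g x \<partial>lebesgue)"
      unfolding scaleR_diff_right using M
      by (intro Bochner_Integration.integral_diff integrable_landau_kernel_times_bounded[OF R]) auto
    also have "(\<integral>y. landau_kernel R n (x - y) *\<^sub>R g x \<partial>lebesgue) = g x"
      using K by (simp add: has_bochner_integral_iff)
    finally have "norm ((\<integral>y. landau_kernel R n (x - y) *\<^sub>R g y \<partial>lebesgue) - g x)
        = norm (\<integral>y. landau_kernel R n (x - y) *\<^sub>R (g y - g x) \<partial>lebesgue)"
      by simp
    also have "\<dots> \<le> (\<integral>y. norm (landau_kernel R n (x - y) *\<^sub>R (g y - g x)) \<partial>lebesgue)"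
      by (rule integral_norm_bound)
    also have "\<dots> \<le> (\<integral>y. e / 2 * landau_kernel R n (x - y)
        + 2 * M * t n * indicator (ball x R) y \<partial>lebesgue)"
    proof (rule integral_mono)
      show "integrable lebesgue (\<lambda>y. norm (landau_kernel R n (x - y) *\<^sub>R (g y - g x)))"
        by (intro integrable_norm integrable_landau_kernel_times_bounded[OF R h hM])
      show "integrable lebesgue (\<lambda>y. e / 2 * landau_kernel R n (x - y)
          + 2 * M * t n * indicator (ball x R) y)"
        using I by (simp add: has_bochner_integral_iff)
      fix y
      note pos = landau_kernel_nonneg[OF R, of n "x - y"]
      have t0: "0 \<le> t n * indicator (ball x R) y"
      proof -
        have "(\<delta>/R)\<^sup>2 \<le> 1" "(\<delta>/2/R)\<^sup>2 \<le> 1"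
          using \<delta>(1,2) R by (intro power_le_one; simp add: divide_simps)+
        then show ?thesis
          unfolding t_def by (intro mult_nonneg_nonneg divide_nonneg_nonneg zero_le_power) auto
      qed
      have "norm (landau_kernel R n (x - y) *\<^sub>R (g y - g x))
          = landau_kernel R n (x - y) * norm (g y - g x)"
        using pos by simp
      also have "\<dots> \<le> e / 2 * landau_kernel R n (x - y) + 2 * M * (t n * indicator (ball x R) y)"
      proof (cases "norm (x - y) < \<delta>")
        case True
        then have "landau_kernel R n (x - y) * norm (g y - g x) \<le> landau_kernel R n (x - y) * (e / 2)"
          using pos \<delta>(3) by (intro mult_left_mono) auto
        then show ?thesis
          using t0 M0 by (simp add: mult.commute add_increasing2)
      next
        case False
        have "indicator (ball 0 R) (x - y) = (indicator (ball x R) y :: real)"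
          by (simp add: indicator_def dist_norm norm_minus_commute[of x y])
        then have "landau_kernel R n (x - y) \<le> t n * indicator (ball x R) y"
          using landau_kernel_tail_le[of \<delta> R "x - y" n] False \<delta>
          by (simp add: t_def)
        then have "landau_kernel R n (x - y) * norm (g y - g x) \<le> t n * indicator (ball x R) y * (2 * M)"
          using pos hM by (intro mult_mono) auto
        moreover have "0 \<le> e / 2 * landau_kernel R n (x - y)"
          using pos e by simp
        ultimately show ?thesis by (simp add: mult.commute)
      qed
      finally show "norm (landau_kernel R n (x - y) *\<^sub>R (g y - g x))
          \<le> e / 2 * landau_kernel R n (x - y) + 2 * M * t n * indicator (ball x R) y"
        by (simp add: mult.assoc)
    qed
    also have "\<dots> = e / 2 + 2 * M * V * t n"
      using I by (simp add: has_bochner_integral_iff mult_ac)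
    finally show ?thesis .
  qed
  from small have "\<forall>\<^sub>F n in sequentially.
      norm ((\<integral>y. landau_kernel R n (x - y) *\<^sub>R g y \<partial>lebesgue) - g x) < e"
  proof eventually_elim
    case (elim n)
    then show ?case using bound[of n] by linarith
  qed
  then show "\<exists>no. \<forall>n\<ge>no.
      norm ((\<integral>y. landau_kernel R n (x - y) *\<^sub>R g y \<partial>lebesgue) - g x) < e"
    by (simp add: eventually_sequentially)
qed

section \<open>Exchanging the curl under a convolution\<close>

lemma finite_measure_lebesgue_on_bounded_open:
  assumes "open \<Omega>" "bounded (\<Omega> :: 'a::euclidean_space set)"
  shows "finite_measure (lebesgue_on \<Omega>)"
  using assms by (intro finite_measure_lebesgue_on bounded_set_imp_lmeasurable) auto

lemma borel_measurable_lebesgue_on_continuous: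
  fixes f :: "'a::euclidean_space \<Rightarrow> 'b::euclidean_space"
  assumes "continuous_on UNIV f"
  shows "f \<in> borel_measurable (lebesgue_on \<Omega>)"
proof -
  have "f \<in> borel_measurable lborel"
    using borel_measurable_continuous_onI[OF assms] by simp
  then show ?thesis
    by (intro measurable_restrict_space1 measurable_completion)
qed

lemma borel_measurable_difference_kernel [measurable]:
  fixes h :: "'a::euclidean_space \<Rightarrow> 'b::euclidean_space"
  assumes "continuous_on UNIV h"
  shows "(\<lambda>(x, y). h (x - y)) \<in> borel_measurable (lebesgue_on \<Omega> \<Otimes>\<^sub>M lebesgue_on \<Omega>)"
proof -
  have [measurable]: "(\<lambda>x::'a. x) \<in> borel_measurable (lebesgue_on \<Omega>)"
    by (rule borel_measurable_lebesgue_on_continuous) (rule continuous_on_id)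
  have [measurable]: "h \<in> borel_measurable borel"
    by (rule borel_measurable_continuous_onI[OF assms])
  show ?thesis by measurable
qed

lemma bounded_on_differences:
  fixes h :: "'a::euclidean_space \<Rightarrow> 'b::euclidean_space"
  assumes "continuous_on UNIV h" "bounded \<Omega>"
  obtains C where "\<And>x y. x \<in> \<Omega> \<Longrightarrow> y \<in> \<Omega> \<Longrightarrow> norm (h (x - y)) \<le> C"
proof -
  obtain r where r: "\<And>x. x \<in> \<Omega> \<Longrightarrow> norm x \<le> r"
    using assms(2) bounded_iff by blast
  have "compact (h ` cball 0 (2 * r))"
    by (intro compact_continuous_image continuous_on_subset[OF assms(1)]) auto
  then obtain C where C: "\<And>z. z \<in> cball 0 (2 * r) \<Longrightarrow> norm (h z) \<le> C"
    using compact_imp_bounded bounded_iff by (metis image_eqI)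
  have "norm (h (x - y)) \<le> C" if "x \<in> \<Omega>" "y \<in> \<Omega>" for x y
  proof (rule C)
    show "x - y \<in> cball 0 (2 * r)"
      using norm_triangle_ineq4[of x y] r[OF that(1)] r[OF that(2)] by simp
  qed
  then show ?thesis using that by blast
qed

lemma norm_cross3_le: "norm (cross3 x y) \<le> norm x * norm y"
proof (rule power2_le_imp_le)
  show "(norm (cross3 x y))\<^sup>2 \<le> (norm x * norm y)\<^sup>2"
    by (simp add: norm_cross power_mult_distrib)
qed simp

lemma borel_measurable_cross3 [measurable]:
  assumes "f \<in> borel_measurable M" "g \<in> borel_measurable M"
  shows "(\<lambda>x. cross3 (f x) (g x)) \<in> borel_measurable M"
  by (rule borel_measurable_continuous_Pair[OF assms])
     (intro continuous_on_cross continuous_intros)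

text \<open>Freezing \<open>x\<close> makes \<open>\<kappa> (x - y) v(x)\<close> a smooth test field in \<open>y\<close> and moves the curl from \<open>w\<close>
  onto the kernel; freezing \<open>y\<close> does the same for \<open>v\<close>. The two integrands that result agree,
  by antisymmetry of the triple product and because \<open>\<kappa> (x - y)\<close> has opposite gradients in \<open>x\<close> and \<open>y\<close>,
  and they are bounded, so Fubini's theorem applies.\<close>

lemma weak_curl_kernel_exchange:
  fixes v w cv cw :: vector_field
  assumes \<Omega>: "open \<Omega>" "bounded \<Omega>"
    and [measurable]: "v \<in> borel_measurable (lebesgue_on \<Omega>)" "w \<in> borel_measurable (lebesgue_on \<Omega>)"
    and bv: "\<And>x. norm (v x) \<le> Mv" and bw: "\<And>x. norm (w x) \<le> Mw"
    and cv: "\<And>\<phi>. smooth_vector \<phi> \<Longrightarrow> ip \<Omega> v (ccurl \<phi>) = ip \<Omega> cv \<phi>"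
    and cw: "\<And>\<phi>. smooth_vector \<phi> \<Longrightarrow> ip \<Omega> w (ccurl \<phi>) = ip \<Omega> cw \<phi>"
    and \<kappa>: "real_polynomial_function \<kappa>"
  shows "(\<integral>x. \<integral>y. \<kappa> (x - y) * (v x \<bullet> cw y) \<partial>lebesgue_on \<Omega> \<partial>lebesgue_on \<Omega>)
       = (\<integral>y. \<integral>x. \<kappa> (x - y) * (w y \<bullet> cv x) \<partial>lebesgue_on \<Omega> \<partial>lebesgue_on \<Omega>)"
proof -
  let ?N = "lebesgue_on \<Omega>"
  let ?F = "\<lambda>x y. v x \<bullet> cross3 (cgrad \<kappa> (x - y)) (w y)"
  interpret N: finite_measure ?N
    by (rule finite_measure_lebesgue_on_bounded_open[OF \<Omega>])
  interpret NN: pair_sigma_finite ?N ?N ..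
  interpret P: finite_measure "?N \<Otimes>\<^sub>M ?N"
    by (rule finite_measure_pair_measure) unfold_locales
  have "(\<integral>y. \<kappa> (x - y) * (v x \<bullet> cw y) \<partial>?N) = (\<integral>y. ?F x y \<partial>?N)" for x
  proof -
    let ?\<phi> = "\<lambda>y. \<kappa> ((-1) *\<^sub>R y + x) *\<^sub>R v x"
    have "(\<integral>y. \<kappa> (x - y) * (v x \<bullet> cw y) \<partial>?N) = ip \<Omega> cw ?\<phi>"
      by (simp add: ip_def inner_commute)
    also have "\<dots> = ip \<Omega> w (ccurl ?\<phi>)"
      by (rule cw[symmetric]) (rule smooth_vector_kernel_slice[OF \<kappa>])
    also have "\<dots> = (\<integral>y. ?F x y \<partial>?N)"
      unfolding ip_def ccurl_kernel_slice[OF \<kappa>]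
      by (intro Bochner_Integration.integral_cong refl) (simp add: cross3_simps)
    finally show ?thesis .
  qed
  moreover have "(\<integral>x. \<kappa> (x - y) * (w y \<bullet> cv x) \<partial>?N) = (\<integral>x. ?F x y \<partial>?N)" for y
  proof -
    let ?\<phi> = "\<lambda>x. \<kappa> (1 *\<^sub>R x + - y) *\<^sub>R w y"
    have "(\<integral>x. \<kappa> (x - y) * (w y \<bullet> cv x) \<partial>?N) = ip \<Omega> cv ?\<phi>"
      by (simp add: ip_def inner_commute)
    also have "\<dots> = ip \<Omega> v (ccurl ?\<phi>)"
      by (rule cv[symmetric]) (rule smooth_vector_kernel_slice[OF \<kappa>])
    also have "\<dots> = (\<integral>x. ?F x y \<partial>?N)"
      unfolding ip_def ccurl_kernel_slice[OF \<kappa>] by simp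
    finally show ?thesis .
  qed
  moreover have "(\<integral>x. \<integral>y. ?F x y \<partial>?N \<partial>?N) = (\<integral>y. \<integral>x. ?F x y \<partial>?N \<partial>?N)"
  proof (rule NN.Fubini_integral[symmetric])
    have D: "continuous_on UNIV (cgrad \<kappa>)"
      by (rule continuous_on_cgrad_real_polynomial[OF \<kappa>])
    obtain C where C: "\<And>x y. x \<in> \<Omega> \<Longrightarrow> y \<in> \<Omega> \<Longrightarrow> norm (cgrad \<kappa> (x - y)) \<le> C"
      using bounded_on_differences[OF D \<Omega>(2)] by blast
    show "integrable (?N \<Otimes>\<^sub>M ?N) (\<lambda>(x, y). ?F x y)"
    proof (rule P.integrable_const_bound[where B = "Mv * (C * Mw)"])
      show "AE p in ?N \<Otimes>\<^sub>M ?N. norm ((\<lambda>(x, y). ?F x y) p) \<le> Mv * (C * Mw)"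
      proof (rule AE_I2, clarify)
        fix x y assume "(x, y) \<in> space (?N \<Otimes>\<^sub>M ?N)"
        then have xy: "x \<in> \<Omega>" "y \<in> \<Omega>"
          by (auto simp: space_pair_measure)
        have "\<bar>?F x y\<bar> \<le> norm (v x) * norm (cross3 (cgrad \<kappa> (x - y)) (w y))"
          by (rule Cauchy_Schwarz_ineq2)
        also have "\<dots> \<le> norm (v x) * (norm (cgrad \<kappa> (x - y)) * norm (w y))"
          by (intro mult_left_mono norm_cross3_le) simp
        also have "\<dots> \<le> Mv * (C * Mw)"
          using C[OF xy] bv[of x] bw[of y]
          by (intro mult_mono) (auto intro: order_trans[OF norm_ge_zero] mult_nonneg_nonneg)
        finally show "norm (?F x y) \<le> Mv * (C * Mw)"
          by simp
      qed
      have [measurable]: "(\<lambda>p. cgrad \<kappa> (fst p - snd p)) \<in> borel_measurable (?N \<Otimes>\<^sub>M ?N)"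
        using borel_measurable_difference_kernel[OF D] by (simp add: case_prod_beta')
      have [measurable]: "(\<lambda>p. cross3 (cgrad \<kappa> (fst p - snd p)) (w (snd p)))
          \<in> borel_measurable (?N \<Otimes>\<^sub>M ?N)"
        by (rule borel_measurable_cross3) measurable
      show "(\<lambda>(x, y). ?F x y) \<in> borel_measurable (?N \<Otimes>\<^sub>M ?N)"
        unfolding case_prod_beta' by measurable
    qed
  qed
  ultimately show ?thesis by simp
qed

section \<open>Removing the regularisation\<close>

text \<open>The Landau kernel without its cut-off. It is a polynomial, hence an admissible factor of test
  fields, and it agrees with the kernel at all differences of points of a set of diameter less than \<open>R\<close>.\<close>

definition landau_polynomial :: "real \<Rightarrow> nat \<Rightarrow> 'a::euclidean_space \<Rightarrow> real" where
  "landau_polynomial R n z = (1 - (norm z / R)\<^sup>2) ^ n / landau_mass TYPE('a) R n"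

lemma landau_polynomial_minus: "landau_polynomial R n (- z) = landau_polynomial R n z"
  by (simp add: landau_polynomial_def)

lemma real_polynomial_function_landau_polynomial:
  "real_polynomial_function (landau_polynomial R n :: 'a::euclidean_space \<Rightarrow> real)"
proof -
  have "real_polynomial_function (\<lambda>z::'a. \<Sum>b\<in>Basis. (z \<bullet> b)\<^sup>2)"
    by (intro real_polynomial_function_sum real_polynomial_function_power
        real_polynomial_function.intros(1) bounded_linear_inner_left) auto
  moreover have "(\<Sum>b\<in>Basis. (z \<bullet> b)\<^sup>2) = (norm z)\<^sup>2" for z :: 'a
    unfolding power2_norm_eq_inner euclidean_inner[of z z] by (simp only: power2_eq_square)
  ultimately have "real_polynomial_function (\<lambda>z::'a. (norm z)\<^sup>2)"
    by (simp only:)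
  from real_polynomial_function_divide[OF this, of "R\<^sup>2"]
  have "real_polynomial_function (\<lambda>z::'a. 1 - (norm z / R)\<^sup>2)"
    unfolding power_divide by (rule real_polynomial_function_diff[OF real_polynomial_function.intros(2)])
  then show ?thesis
    unfolding landau_polynomial_def[abs_def]
    by (intro real_polynomial_function_divide real_polynomial_function_power)
qed

lemma landau_polynomial_eq_kernel:
  "norm z < R \<Longrightarrow> landau_polynomial R n z = landau_kernel R n z"
  by (simp add: landau_polynomial_def landau_kernel_def landau_def)

text \<open>The inner integrals are Landau means of \<open>b\<close> extended by zero; since the domain is open, the extension
  is continuous wherever \<open>b\<close> is. They are bounded by the bound of \<open>b\<close> and converge almost
  everywhere, so dominated convergence applies to the outer integral.\<close>

lemma landau_double_integral_tendsto:
  fixes a b :: "'a::euclidean_space \<Rightarrow> 'b::euclidean_space"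
  assumes \<Omega>: "open \<Omega>" "bounded \<Omega>"
    and R: "0 < R" "\<And>x y. x \<in> \<Omega> \<Longrightarrow> y \<in> \<Omega> \<Longrightarrow> norm (x - y) < R"
    and [measurable]: "a \<in> borel_measurable (lebesgue_on \<Omega>)" "b \<in> borel_measurable (lebesgue_on \<Omega>)"
    and ba: "\<And>x. norm (a x) \<le> Ma" and bb: "\<And>x. norm (b x) \<le> Mb"
    and cont: "AE x in lebesgue_on \<Omega>. isCont b x"
  shows "(\<lambda>n. \<integral>x. \<integral>y. landau_polynomial R n (x - y) * (a x \<bullet> b y) \<partial>lebesgue_on \<Omega> \<partial>lebesgue_on \<Omega>)
      \<longlonglongrightarrow> (\<integral>x. a x \<bullet> b x \<partial>lebesgue_on \<Omega>)"
proof -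
  let ?N = "lebesgue_on \<Omega>"
  interpret N: finite_measure ?N
    by (rule finite_measure_lebesgue_on_bounded_open[OF \<Omega>])
  have meas: "\<Omega> \<in> sets lebesgue" using \<Omega> by auto
  have Ma: "0 \<le> Ma" and Mb: "0 \<le> Mb"
    using ba bb norm_ge_zero order_trans by blast+
  define g where "g y = indicator \<Omega> y *\<^sub>R b y" for y
  have g_meas: "g \<in> borel_measurable lebesgue"
    unfolding g_def by (subst borel_measurable_restrict_space_iff[symmetric]) (use meas in auto)
  have g_bound: "norm (g y) \<le> Mb" for y
    using bb[of y] Mb by (auto simp: g_def indicator_def)
  have inner_eq: "(\<integral>y. landau_polynomial R n (x - y) * (a x \<bullet> b y) \<partial>?N)
      = a x \<bullet> (\<integral>y. landau_kernel R n (x - y) *\<^sub>R g y \<partial>lebesgue)" if x: "x \<in> \<Omega>" for n x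
  proof -
    have "(\<integral>y. landau_polynomial R n (x - y) * (a x \<bullet> b y) \<partial>?N)
        = (\<integral>y. indicator \<Omega> y *\<^sub>R (landau_polynomial R n (x - y) * (a x \<bullet> b y)) \<partial>lebesgue)"
      using meas by (intro integral_restrict_space) auto
    also have "\<dots> = (\<integral>y. a x \<bullet> (landau_kernel R n (x - y) *\<^sub>R g y) \<partial>lebesgue)"
      using R(2)[OF x]
      by (intro Bochner_Integration.integral_cong refl)
        (auto simp: g_def indicator_def landau_polynomial_eq_kernel)
    also have "\<dots> = a x \<bullet> (\<integral>y. landau_kernel R n (x - y) *\<^sub>R g y \<partial>lebesgue)"
      by (intro integral_inner_right integrable_landau_kernel_times_bounded[OF R(1) g_meas g_bound])
    finally show ?thesis .
  qed
  show ?thesis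
  proof (rule integral_dominated_convergence[where w = "\<lambda>_. Ma * Mb"])
    show "(\<lambda>x. a x \<bullet> b x) \<in> borel_measurable ?N" by measurable
    have [measurable]: "(\<lambda>p. landau_polynomial R n (fst p - snd p)) \<in> borel_measurable (?N \<Otimes>\<^sub>M ?N)"
      for n
      using borel_measurable_difference_kernel[OF continuous_on_polymonial_function,
          of "landau_polynomial R n" \<Omega>]
        real_polynomial_function_landau_polynomial[of R n, where 'a='a]
      by (simp add: case_prod_beta' real_polynomial_function_eq)
    have "(\<lambda>(x, y). landau_polynomial R n (x - y) * (a x \<bullet> b y)) \<in> borel_measurable (?N \<Otimes>\<^sub>M ?N)" for n
      unfolding case_prod_beta' by measurable
    then show "(\<lambda>x. \<integral>y. landau_polynomial R n (x - y) * (a x \<bullet> b y) \<partial>?N) \<in> borel_measurable ?N" for n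
      by (rule N.borel_measurable_lebesgue_integral)
    show "integrable ?N (\<lambda>_. Ma * Mb)" by simp
    show "AE x in ?N. norm (\<integral>y. landau_polynomial R n (x - y) * (a x \<bullet> b y) \<partial>?N) \<le> Ma * Mb" for n
    proof (rule AE_I2)
      fix x assume "x \<in> space ?N"
      then have x: "x \<in> \<Omega>" by simp
      have "\<bar>a x \<bullet> (\<integral>y. landau_kernel R n (x - y) *\<^sub>R g y \<partial>lebesgue)\<bar>
          \<le> norm (a x) * norm (\<integral>y. landau_kernel R n (x - y) *\<^sub>R g y \<partial>lebesgue)"
        by (rule Cauchy_Schwarz_ineq2)
      also have "\<dots> \<le> Ma * Mb"
        using ba norm_landau_mean_le[OF R(1) g_meas g_bound] Ma by (intro mult_mono) auto
      finally show "norm (\<integral>y. landau_polynomial R n (x - y) * (a x \<bullet> b y) \<partial>?N) \<le> Ma * Mb"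
        using inner_eq[OF x] by simp
    qed
    show "AE x in ?N. (\<lambda>n. \<integral>y. landau_polynomial R n (x - y) * (a x \<bullet> b y) \<partial>?N) \<longlonglongrightarrow> a x \<bullet> b x"
      using cont AE_space
    proof eventually_elim
      case (elim x)
      then have x: "x \<in> \<Omega>" by simp
      have "\<forall>\<^sub>F y in nhds x. g y = b y"
        using eventually_nhds_in_open[OF \<Omega>(1) x] by eventually_elim (simp add: g_def)
      then have "isCont g x"
        using elim(1) by (simp only: isCont_cong)
      then have "(\<lambda>n. \<integral>y. landau_kernel R n (x - y) *\<^sub>R g y \<partial>lebesgue) \<longlonglongrightarrow> g x"
        by (rule landau_mean_tendsto[OF R(1) g_meas g_bound])
      then have "(\<lambda>n. a x \<bullet> (\<integral>y. landau_kernel R n (x - y) *\<^sub>R g y \<partial>lebesgue)) \<longlonglongrightarrow> a x \<bullet> g x"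
        by (rule tendsto_inner[OF tendsto_const])
      moreover have "g x = b x"
        using x by (simp add: g_def)
      ultimately show ?case
        unfolding inner_eq[OF x] by metis
    qed
  qed
qed

lemma ip_commute: "ip \<Omega> v w = ip \<Omega> w v"
  by (simp add: ip_def inner_commute)

text \<open>Both fields satisfy the weak identity against all smooth fields on the whole space, not only the
  compactly supported ones; this encodes their vanishing tangential trace, and without it a boundary
  term would remain.\<close>

lemma weak_curl_symmetric:
  fixes v w cv cw :: vector_field
  assumes \<Omega>: "open \<Omega>" "bounded \<Omega>"
    and meas: "v \<in> borel_measurable (lebesgue_on \<Omega>)" "w \<in> borel_measurable (lebesgue_on \<Omega>)"
      "cv \<in> borel_measurable (lebesgue_on \<Omega>)" "cw \<in> borel_measurable (lebesgue_on \<Omega>)"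
    and bnd: "\<And>x. norm (v x) \<le> M1" "\<And>x. norm (w x) \<le> M2"
      "\<And>x. norm (cv x) \<le> M3" "\<And>x. norm (cw x) \<le> M4"
    and cont: "AE x in lebesgue_on \<Omega>. isCont cv x" "AE x in lebesgue_on \<Omega>. isCont cw x"
    and cv: "\<And>\<phi>. smooth_vector \<phi> \<Longrightarrow> ip \<Omega> v (ccurl \<phi>) = ip \<Omega> cv \<phi>"
    and cw: "\<And>\<phi>. smooth_vector \<phi> \<Longrightarrow> ip \<Omega> w (ccurl \<phi>) = ip \<Omega> cw \<phi>"
  shows "ip \<Omega> v cw = ip \<Omega> cv w"
proof -
  obtain r where r: "\<And>x. x \<in> \<Omega> \<Longrightarrow> norm x \<le> r"
    using \<Omega>(2) bounded_iff by blast
  define R where "R = 2 * \<bar>r\<bar> + 1"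
  have R: "0 < R" "\<And>x y. x \<in> \<Omega> \<Longrightarrow> y \<in> \<Omega> \<Longrightarrow> norm (x - y) < R"
  proof -
    show "0 < R" by (simp add: R_def)
    show "norm (x - y) < R" if "x \<in> \<Omega>" "y \<in> \<Omega>" for x y
      using norm_triangle_ineq4[of x y] r[OF that(1)] r[OF that(2)] unfolding R_def by linarith
  qed
  let ?I = "\<lambda>n a b. \<integral>x. \<integral>y. landau_polynomial R n (x - y) * (a x \<bullet> b y) \<partial>lebesgue_on \<Omega> \<partial>lebesgue_on \<Omega>"
  have "?I n v cw = ?I n w cv" for n
  proof -
    note weak_curl_kernel_exchange[OF \<Omega> meas(1,2) bnd(1,2) cv cw
        real_polynomial_function_landau_polynomial[of R n]]
    also have "(\<integral>y. \<integral>x. landau_polynomial R n (x - y) * (w y \<bullet> cv x)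
        \<partial>lebesgue_on \<Omega> \<partial>lebesgue_on \<Omega>) = ?I n w cv"
    proof (intro Bochner_Integration.integral_cong refl)
      fix x y
      show "landau_polynomial R n (x - y) * (w y \<bullet> cv x) = landau_polynomial R n (y - x) * (w y \<bullet> cv x)"
        using landau_polynomial_minus[of R n "x - y"] by simp
    qed
    finally show ?thesis .
  qed
  then have eq: "(\<lambda>n. ?I n v cw) = (\<lambda>n. ?I n w cv)"
    by (rule ext)
  have "(\<lambda>n. ?I n v cw) \<longlonglongrightarrow> ip \<Omega> v cw"
    unfolding ip_def
    by (rule landau_double_integral_tendsto[OF \<Omega> R meas(1,4) bnd(1,4) cont(2)])
  then have "(\<lambda>n. ?I n w cv) \<longlonglongrightarrow> ip \<Omega> v cw"
    unfolding eq .
  moreover have "(\<lambda>n. ?I n w cv) \<longlonglongrightarrow> ip \<Omega> w cv"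
    unfolding ip_def
    by (rule landau_double_integral_tendsto[OF \<Omega> R meas(2,3) bnd(2,3) cont(1)])
  ultimately have "ip \<Omega> v cw = ip \<Omega> w cv"
    by (rule LIMSEQ_unique)
  also have "\<dots> = ip \<Omega> cv w"
    by (rule ip_commute)
  finally show ?thesis .
qed

section \<open>Piecewise polynomial fields and the Green formula for the curl\<close>

lemma ip_cong:
  assumes "f \<in> borel_measurable (lebesgue_on \<Omega>)" "f' \<in> borel_measurable (lebesgue_on \<Omega>)"
    "g \<in> borel_measurable (lebesgue_on \<Omega>)" "g' \<in> borel_measurable (lebesgue_on \<Omega>)"
    and "aeq \<Omega> f f'" "aeq \<Omega> g g'"
  shows "ip \<Omega> f g = ip \<Omega> f' g'"
  unfolding ip_def
proof (rule integral_cong_AE)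
  show "AE x in lebesgue_on \<Omega>. f x \<bullet> g x = f' x \<bullet> g' x"
    using assms(5,6) unfolding aeq_def by eventually_elim simp
qed (use assms in measurable)

lemma aeq_refl: "aeq \<Omega> f f"
  by (simp add: aeq_def)

lemma AE_lebesgue_on_cell:
  assumes "open K" "open \<Omega>" "K \<subseteq> \<Omega>" "AE x in lebesgue_on K. P x"
  shows "AE x in lebesgue_on \<Omega>. x \<in> K \<longrightarrow> P x"
proof -
  have "AE x in lebesgue. x \<in> K \<longrightarrow> P x"
    using assms by (subst (asm) AE_restrict_space_iff) auto
  then show ?thesis
    using assms by (subst AE_restrict_space_iff) (auto elim: eventually_mono)
qed

lemma AE_in_mesh_cell:
  assumes "mesh \<Omega> T" "open \<Omega>"
  shows "AE x in lebesgue_on \<Omega>. x \<in> \<Union>T"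
proof -
  have "\<Omega> - \<Union>T \<in> null_sets lebesgue"
    using assms by (simp add: mesh_def negligible_iff_null_sets)
  then have "AE x in lebesgue. x \<notin> \<Omega> - \<Union>T"
    by (rule AE_not_in)
  then show ?thesis
    using assms by (subst AE_restrict_space_iff) (auto elim: eventually_mono)
qed

text \<open>On each open cell the field is replaced by its polynomial, elsewhere by zero. The result is continuous
  at every point of every cell, and the cells cover the domain up to a null set.\<close>

lemma piecewise_polynomial_bounded_representative:
  fixes v :: "real^3 \<Rightarrow> 'b::euclidean_space"
  assumes m: "mesh \<Omega> T" and \<Omega>: "open \<Omega>" "bounded \<Omega>" and v: "piecewise_polynomial T v"
  obtains v' M where "v' \<in> borel_measurable (lebesgue_on \<Omega>)" "\<And>x. norm (v' x) \<le> M"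
    "AE x in lebesgue_on \<Omega>. isCont v' x" "aeq \<Omega> v v'"
proof -
  have T: "finite T" "disjoint T" "\<And>K. K \<in> T \<Longrightarrow> open K" "\<And>K. K \<in> T \<Longrightarrow> K \<subseteq> \<Omega>"
    using m by (auto simp: mesh_def)
  obtain p where p: "\<And>K. K \<in> T \<Longrightarrow> polynomial_function (p K)"
      and pv: "\<And>K. K \<in> T \<Longrightarrow> aeq K v (p K)"
    using v unfolding piecewise_polynomial_def by metis
  define v' where "v' x = (\<Sum>K\<in>T. indicator K x *\<^sub>R p K x)" for x
  have v'_cell: "v' x = p K x" if "K \<in> T" "x \<in> K" for K x
  proof -
    have "indicator L x *\<^sub>R p L x = 0" if "L \<in> T - {K}" for L
      using that \<open>K \<in> T\<close> \<open>x \<in> K\<close> T(2) by (auto simp: pairwise_def disjnt_iff indicator_def)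
    then have "v' x = (\<Sum>L\<in>{K}. indicator L x *\<^sub>R p L x)"
      unfolding v'_def using T(1) that by (intro sum.mono_neutral_right) auto
    then show ?thesis using that by simp
  qed
  have cont: "continuous_on S (p K)" if "K \<in> T" for K S
    using p[OF that] by (rule continuous_on_polymonial_function)
  have "\<exists>C. \<forall>x\<in>K. norm (p K x) \<le> C" if "K \<in> T" for K
  proof -
    have "bounded K" using T(4)[OF that] \<Omega>(2) bounded_subset by blast
    then have "compact (p K ` closure K)"
      by (intro compact_continuous_image cont that) simp
    then show ?thesis
      using compact_imp_bounded bounded_iff closure_subset by (metis image_eqI subsetD)
  qed
  then obtain C where C: "\<And>K x. K \<in> T \<Longrightarrow> x \<in> K \<Longrightarrow> norm (p K x) \<le> C K"
    by metis
  show ?thesis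
  proof (rule that[of v' "\<Sum>K\<in>T. \<bar>C K\<bar>"])
    have "(\<lambda>x. indicator K x *\<^sub>R p K x) \<in> borel_measurable (lebesgue_on \<Omega>)" if "K \<in> T" for K
    proof -
      have [measurable]: "p K \<in> borel_measurable (lebesgue_on \<Omega>)"
        by (rule borel_measurable_lebesgue_on_continuous[OF cont[OF that]])
      have "K \<in> sets (lebesgue_on \<Omega>)"
        using T(3,4)[OF that] \<Omega>(1) by (auto simp: sets_restrict_space_iff)
      then have [measurable]: "(indicator K :: _ \<Rightarrow> real) \<in> borel_measurable (lebesgue_on \<Omega>)"
        by (rule borel_measurable_indicator)
      show ?thesis by measurable
    qed
    then show "v' \<in> borel_measurable (lebesgue_on \<Omega>)"
      unfolding v'_def[abs_def] by (rule borel_measurable_sum)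
    show "norm (v' x) \<le> (\<Sum>K\<in>T. \<bar>C K\<bar>)" for x
      unfolding v'_def using C
      by (intro sum_norm_le) (force simp: indicator_def intro: order_trans)
    show "AE x in lebesgue_on \<Omega>. isCont v' x"
      using AE_in_mesh_cell[OF m \<Omega>(1)]
    proof eventually_elim
      case (elim x)
      then obtain K where K: "K \<in> T" "x \<in> K" by blast
      have "\<forall>\<^sub>F y in nhds x. v' y = p K y"
        using eventually_nhds_in_open[OF T(3)[OF K(1)] K(2)]
        by eventually_elim (rule v'_cell[OF K(1)])
      moreover have "isCont (p K) x"
        using cont[OF K(1), of UNIV] by (simp add: continuous_on_eq_continuous_at)
      ultimately show ?case
        using isCont_cong by blast
    qed
    have "AE x in lebesgue_on \<Omega>. \<forall>K\<in>T. x \<in> K \<longrightarrow> v x = p K x"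
      using T pv \<Omega>(1) by (intro AE_finite_allI AE_lebesgue_on_cell) (auto simp: aeq_def)
    with AE_in_mesh_cell[OF m \<Omega>(1)] show "aeq \<Omega> v v'"
      unfolding aeq_def by eventually_elim (auto simp: v'_cell)
  qed
qed

lemma H0_curl_weak_identity:
  assumes "v \<in> H0_curl \<Omega>" "smooth_vector \<phi>"
  shows "ip \<Omega> v (ccurl \<phi>) = ip \<Omega> (wcurl \<Omega> v) \<phi>"
  using assms by (simp add: H0_curl_def tangential_trace_def)

text \<open>The Green formula for the curl. All four fields are replaced by bounded representatives that are
  continuous almost everywhere, which changes no integral.\<close>

lemma wcurl_symmetric:
  fixes v w :: vector_field
  assumes m: "mesh \<Omega> T" and \<Omega>: "open \<Omega>" "bounded \<Omega>"
    and v: "v \<in> H0_curl \<Omega>" "v \<in> L2 \<Omega>" "piecewise_polynomial T v"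
    and w: "w \<in> H0_curl \<Omega>" "w \<in> L2 \<Omega>" "piecewise_polynomial T w"
    and cv: "wcurl \<Omega> v \<in> L2 \<Omega>" "piecewise_polynomial T (wcurl \<Omega> v)"
    and cw: "wcurl \<Omega> w \<in> L2 \<Omega>" "piecewise_polynomial T (wcurl \<Omega> w)"
  shows "ip \<Omega> v (wcurl \<Omega> w) = ip \<Omega> (wcurl \<Omega> v) w"
proof -
  note rep = piecewise_polynomial_bounded_representative[OF m \<Omega>]
  obtain v' M1 where v': "v' \<in> borel_measurable (lebesgue_on \<Omega>)" "\<And>x. norm (v' x) \<le> M1"
      "AE x in lebesgue_on \<Omega>. isCont v' x" "aeq \<Omega> v v'"
    using rep[OF v(3)] by blast
  obtain w' M2 where w': "w' \<in> borel_measurable (lebesgue_on \<Omega>)" "\<And>x. norm (w' x) \<le> M2"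
      "AE x in lebesgue_on \<Omega>. isCont w' x" "aeq \<Omega> w w'"
    using rep[OF w(3)] by blast
  obtain cv' M3 where cv': "cv' \<in> borel_measurable (lebesgue_on \<Omega>)" "\<And>x. norm (cv' x) \<le> M3"
      "AE x in lebesgue_on \<Omega>. isCont cv' x" "aeq \<Omega> (wcurl \<Omega> v) cv'"
    using rep[OF cv(2)] by blast
  obtain cw' M4 where cw': "cw' \<in> borel_measurable (lebesgue_on \<Omega>)" "\<And>x. norm (cw' x) \<le> M4"
      "AE x in lebesgue_on \<Omega>. isCont cw' x" "aeq \<Omega> (wcurl \<Omega> w) cw'"
    using rep[OF cw(2)] by blast
  have meas: "v \<in> borel_measurable (lebesgue_on \<Omega>)" "w \<in> borel_measurable (lebesgue_on \<Omega>)"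
      "wcurl \<Omega> v \<in> borel_measurable (lebesgue_on \<Omega>)" "wcurl \<Omega> w \<in> borel_measurable (lebesgue_on \<Omega>)"
    using v w cv cw by (auto simp: L2_def)
  have weak: "ip \<Omega> z' (ccurl \<phi>) = ip \<Omega> c' \<phi>"
    if "z \<in> H0_curl \<Omega>" "smooth_vector \<phi>" "aeq \<Omega> z z'" "aeq \<Omega> (wcurl \<Omega> z) c'"
      "z \<in> borel_measurable (lebesgue_on \<Omega>)" "z' \<in> borel_measurable (lebesgue_on \<Omega>)"
      "wcurl \<Omega> z \<in> borel_measurable (lebesgue_on \<Omega>)" "c' \<in> borel_measurable (lebesgue_on \<Omega>)"
    for z z' c' \<phi>
  proof -
    have \<phi>: "\<phi> \<in> borel_measurable (lebesgue_on \<Omega>)" "ccurl \<phi> \<in> borel_measurable (lebesgue_on \<Omega>)"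
      using smooth_vector_continuous[OF that(2)]
      by (auto intro: borel_measurable_lebesgue_on_continuous)
    have "ip \<Omega> z' (ccurl \<phi>) = ip \<Omega> z (ccurl \<phi>)"
      using that \<phi> by (intro ip_cong[symmetric] aeq_refl)
    also have "\<dots> = ip \<Omega> (wcurl \<Omega> z) \<phi>"
      by (rule H0_curl_weak_identity[OF that(1,2)])
    also have "\<dots> = ip \<Omega> c' \<phi>"
      using that \<phi> by (intro ip_cong aeq_refl)
    finally show ?thesis .
  qed
  have "ip \<Omega> v (wcurl \<Omega> w) = ip \<Omega> v' cw'"
    by (intro ip_cong meas v' cw')
  also have "\<dots> = ip \<Omega> cv' w'"
  proof (rule weak_curl_symmetric[OF \<Omega> v'(1) w'(1) cv'(1) cw'(1) v'(2) w'(2) cv'(2) cw'(2) cv'(3) cw'(3)])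
    show "ip \<Omega> v' (ccurl \<phi>) = ip \<Omega> cv' \<phi>" if "smooth_vector \<phi>" for \<phi>
      by (rule weak[OF v(1) that v'(4) cv'(4) meas(1) v'(1) meas(3) cv'(1)])
    show "ip \<Omega> w' (ccurl \<phi>) = ip \<Omega> cw' \<phi>" if "smooth_vector \<phi>" for \<phi>
      by (rule weak[OF w(1) that w'(4) cw'(4) meas(2) w'(1) meas(4) cw'(1)])
  qed
  also have "\<dots> = ip \<Omega> (wcurl \<Omega> v) w"
    by (intro ip_cong[symmetric] meas w' cv')
  finally show ?thesis .
qed

section \<open>Bilinearity of the inner product on essentially bounded fields\<close>

text \<open>Essential boundedness, unlike square integrability, is preserved by the cross product, so all
  the trilinear terms of the scheme are integrable and can be split.\<close>

definition ess_bounded :: "(real^3) set \<Rightarrow> vector_field \<Rightarrow> bool" where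
  "ess_bounded \<Omega> v \<longleftrightarrow> v \<in> borel_measurable (lebesgue_on \<Omega>) \<and>
     (\<exists>M. AE x in lebesgue_on \<Omega>. norm (v x) \<le> M)"

lemma ess_bounded_add:
  assumes "ess_bounded \<Omega> v" "ess_bounded \<Omega> w"
  shows "ess_bounded \<Omega> (\<lambda>x. v x + w x)"
proof -
  obtain M1 M2 where [measurable]: "v \<in> borel_measurable (lebesgue_on \<Omega>)"
      "w \<in> borel_measurable (lebesgue_on \<Omega>)"
    and "AE x in lebesgue_on \<Omega>. norm (v x) \<le> M1" "AE x in lebesgue_on \<Omega>. norm (w x) \<le> M2"
    using assms unfolding ess_bounded_def by blast
  from this(3,4) have "AE x in lebesgue_on \<Omega>. norm (v x + w x) \<le> M1 + M2"
    by eventually_elim (rule norm_triangle_mono)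
  moreover have "(\<lambda>x. v x + w x) \<in> borel_measurable (lebesgue_on \<Omega>)" by measurable
  ultimately show ?thesis unfolding ess_bounded_def by blast
qed

lemma ess_bounded_scaleR:
  assumes "ess_bounded \<Omega> v"
  shows "ess_bounded \<Omega> (\<lambda>x. a *\<^sub>R v x)"
proof -
  obtain M where [measurable]: "v \<in> borel_measurable (lebesgue_on \<Omega>)"
    and "AE x in lebesgue_on \<Omega>. norm (v x) \<le> M"
    using assms unfolding ess_bounded_def by blast
  from this(2) have "AE x in lebesgue_on \<Omega>. norm (a *\<^sub>R v x) \<le> \<bar>a\<bar> * M"
    by eventually_elim (simp add: mult_left_mono)
  moreover have "(\<lambda>x. a *\<^sub>R v x) \<in> borel_measurable (lebesgue_on \<Omega>)" by measurable
  ultimately show ?thesis unfolding ess_bounded_def by blast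
qed

lemma ess_bounded_diff:
  assumes "ess_bounded \<Omega> v" "ess_bounded \<Omega> w"
  shows "ess_bounded \<Omega> (\<lambda>x. v x - w x)"
  using ess_bounded_add[OF assms(1) ess_bounded_scaleR[OF assms(2), of "-1"]] by simp

lemma ess_bounded_cross3:
  assumes "ess_bounded \<Omega> v" "ess_bounded \<Omega> w"
  shows "ess_bounded \<Omega> (\<lambda>x. cross3 (v x) (w x))"
proof -
  obtain M1 M2 where [measurable]: "v \<in> borel_measurable (lebesgue_on \<Omega>)"
      "w \<in> borel_measurable (lebesgue_on \<Omega>)"
    and "AE x in lebesgue_on \<Omega>. norm (v x) \<le> M1" "AE x in lebesgue_on \<Omega>. norm (w x) \<le> M2"
    using assms unfolding ess_bounded_def by blast
  from this(3,4) have "AE x in lebesgue_on \<Omega>. norm (cross3 (v x) (w x)) \<le> M1 * M2"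
  proof eventually_elim
    case (elim x)
    then have "norm (v x) * norm (w x) \<le> M1 * M2"
      by (intro mult_mono) (auto intro: order_trans[OF norm_ge_zero])
    then show ?case using norm_cross3_le order_trans by blast
  qed
  moreover have "(\<lambda>x. cross3 (v x) (w x)) \<in> borel_measurable (lebesgue_on \<Omega>)" by measurable
  ultimately show ?thesis unfolding ess_bounded_def by blast
qed

lemma integrable_ess_bounded_inner:
  assumes "finite_measure (lebesgue_on \<Omega>)" "ess_bounded \<Omega> v" "ess_bounded \<Omega> w"
  shows "integrable (lebesgue_on \<Omega>) (\<lambda>x. v x \<bullet> w x)"
proof -
  obtain M1 M2 where [measurable]: "v \<in> borel_measurable (lebesgue_on \<Omega>)"
      "w \<in> borel_measurable (lebesgue_on \<Omega>)"
    and M: "AE x in lebesgue_on \<Omega>. norm (v x) \<le> M1" "AE x in lebesgue_on \<Omega>. norm (w x) \<le> M2"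
    using assms(2,3) unfolding ess_bounded_def by blast
  show ?thesis
  proof (rule finite_measure.integrable_const_bound[OF assms(1), where B = "M1 * M2"])
    from M show "AE x in lebesgue_on \<Omega>. norm (v x \<bullet> w x) \<le> M1 * M2"
    proof eventually_elim
      case (elim x)
      then have "norm (v x) * norm (w x) \<le> M1 * M2"
        by (intro mult_mono) (auto intro: order_trans[OF norm_ge_zero])
      then show ?case using Cauchy_Schwarz_ineq2[of "v x" "w x"] by simp
    qed
  qed measurable
qed

lemma ip_add_left:
  assumes "finite_measure (lebesgue_on \<Omega>)" "ess_bounded \<Omega> v" "ess_bounded \<Omega> w" "ess_bounded \<Omega> z"
  shows "ip \<Omega> (\<lambda>x. v x + w x) z = ip \<Omega> v z + ip \<Omega> w z"
  unfolding ip_def inner_add_left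
  by (intro Bochner_Integration.integral_add integrable_ess_bounded_inner assms)

lemma ip_diff_left:
  assumes "finite_measure (lebesgue_on \<Omega>)" "ess_bounded \<Omega> v" "ess_bounded \<Omega> w" "ess_bounded \<Omega> z"
  shows "ip \<Omega> (\<lambda>x. v x - w x) z = ip \<Omega> v z - ip \<Omega> w z"
  unfolding ip_def inner_diff_left
  by (intro Bochner_Integration.integral_diff integrable_ess_bounded_inner assms)

lemma ip_scaleR_left: "ip \<Omega> (\<lambda>x. a *\<^sub>R v x) z = a * ip \<Omega> v z"
  by (simp add: ip_def)

lemma aeq_zero_if_ip_self_zero:
  assumes "finite_measure (lebesgue_on \<Omega>)" "ess_bounded \<Omega> v" "ip \<Omega> v v = 0"
  shows "aeq \<Omega> v (\<lambda>x. 0)"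
proof -
  have "AE x in lebesgue_on \<Omega>. v x \<bullet> v x = 0"
    using integral_nonneg_eq_0_iff_AE[OF integrable_ess_bounded_inner[OF assms(1,2,2)]] assms(3)
    by (simp add: ip_def)
  then show ?thesis by (simp add: aeq_def)
qed

lemma ess_bounded_piecewise_polynomial:
  assumes "mesh \<Omega> T" "open \<Omega>" "bounded \<Omega>" "v \<in> L2 \<Omega>" "piecewise_polynomial T v"
  shows "ess_bounded \<Omega> v"
proof -
  obtain v' M where v': "v' \<in> borel_measurable (lebesgue_on \<Omega>)" "\<And>x. norm (v' x) \<le> M"
      "AE x in lebesgue_on \<Omega>. isCont v' x" "aeq \<Omega> v v'"
    using piecewise_polynomial_bounded_representative[OF assms(1,2,3,5)] by blast
  from v'(2,4) have "AE x in lebesgue_on \<Omega>. norm (v x) \<le> M"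
    unfolding aeq_def by (auto elim: eventually_mono)
  then show ?thesis using assms(4) by (auto simp: ess_bounded_def L2_def)
qed

section \<open>Discrete time derivatives and orthogonality\<close>

lemma Dt_eq: "Dt \<Delta>t a n = (\<lambda>x. inverse \<Delta>t *\<^sub>R (a (Suc n) x - a n x))"
  by (simp add: Dt_def)

lemma mid_eq: "mid a n = (\<lambda>x. inverse 2 *\<^sub>R (a (Suc n) x + a n x))"
  by (simp add: mid_def)

lemma ess_bounded_mid:
  assumes "\<And>n. ess_bounded \<Omega> (a n)"
  shows "ess_bounded \<Omega> (mid a n)"
  unfolding mid_eq by (intro ess_bounded_scaleR ess_bounded_add assms)

lemma ip_Dt_left:
  assumes "finite_measure (lebesgue_on \<Omega>)" "\<And>n. ess_bounded \<Omega> (a n)" "ess_bounded \<Omega> z"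
  shows "ip \<Omega> (Dt \<Delta>t a n) z = (ip \<Omega> (a (Suc n)) z - ip \<Omega> (a n) z) / \<Delta>t"
  unfolding Dt_eq ip_scaleR_left by (simp add: ip_diff_left assms field_simps)

lemma ip_mid_left:
  assumes "finite_measure (lebesgue_on \<Omega>)" "\<And>n. ess_bounded \<Omega> (a n)" "ess_bounded \<Omega> z"
  shows "ip \<Omega> (mid a n) z = (ip \<Omega> (a (Suc n)) z + ip \<Omega> (a n) z) / 2"
  unfolding mid_eq ip_scaleR_left by (simp add: ip_add_left assms)

lemma ip_Dt_mid:
  assumes "finite_measure (lebesgue_on \<Omega>)" "\<And>n. ess_bounded \<Omega> (a n)" "\<And>n. ess_bounded \<Omega> (b n)"
  shows "ip \<Omega> (Dt \<Delta>t a n) (mid b n) =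
    (ip \<Omega> (a (Suc n)) (b (Suc n)) + ip \<Omega> (a (Suc n)) (b n)
     - ip \<Omega> (a n) (b (Suc n)) - ip \<Omega> (a n) (b n)) / (2 * \<Delta>t)"
proof -
  have "ip \<Omega> (a k) (mid b n) = (ip \<Omega> (a k) (b (Suc n)) + ip \<Omega> (a k) (b n)) / 2" for k
    using ip_mid_left[where a = b and z = "a k", OF assms(1,3,2)] by (simp add: ip_commute)
  moreover have "ip \<Omega> (Dt \<Delta>t a n) (mid b n) = (ip \<Omega> (a (Suc n)) (mid b n) - ip \<Omega> (a n) (mid b n)) / \<Delta>t"
    by (intro ip_Dt_left ess_bounded_mid assms)
  ultimately show ?thesis
    by (simp add: diff_divide_distrib add_divide_distrib)
qed

text \<open>The midpoint rule is exact for quadratic invariants: there is no remainder of higher order in the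
  time step.\<close>

lemma Dt_integral_product_rule:
  assumes "finite_measure (lebesgue_on \<Omega>)" "\<And>n. ess_bounded \<Omega> (a n)" "\<And>n. ess_bounded \<Omega> (b n)"
  shows "Dt_integral \<Omega> \<Delta>t a b n = ip \<Omega> (Dt \<Delta>t a n) (mid b n) + ip \<Omega> (mid a n) (Dt \<Delta>t b n)"
  using ip_Dt_mid[where a = a and b = b, OF assms] ip_Dt_mid[where a = b and b = a, OF assms(1,3,2)]
  unfolding Dt_integral_def ip_commute[of \<Omega> "mid a n"]
  by (simp add: ip_commute[of \<Omega> "b _"] diff_divide_distrib add_divide_distrib)

text \<open>For \<open>b\<close> a potential of \<open>a\<close>, symmetry of the curl supplies the last hypothesis, and both terms of
  the product rule coincide.\<close>

lemma Dt_integral_product_rule_symmetric: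
  assumes "finite_measure (lebesgue_on \<Omega>)" "\<And>n. ess_bounded \<Omega> (a n)" "\<And>n. ess_bounded \<Omega> (b n)"
    and "ip \<Omega> (a n) (b (Suc n)) = ip \<Omega> (a (Suc n)) (b n)"
  shows "Dt_integral \<Omega> \<Delta>t a b n = 2 * ip \<Omega> (Dt \<Delta>t a n) (mid b n)"
  using ip_Dt_mid[where a = a and b = b, OF assms(1-3)] assms(4)
  by (simp add: Dt_integral_def diff_divide_distrib add_divide_distrib)

lemma L2_subspace_add:
  "L2_subspace \<Omega> V \<Longrightarrow> f \<in> V \<Longrightarrow> g \<in> V \<Longrightarrow> (\<lambda>x. f x + g x) \<in> V"
  by (simp add: L2_subspace_def)

lemma L2_subspace_scaleR:
  "L2_subspace \<Omega> V \<Longrightarrow> f \<in> V \<Longrightarrow> (\<lambda>x. a *\<^sub>R f x) \<in> V"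
  by (simp add: L2_subspace_def)

lemma L2_subspace_mid:
  assumes "L2_subspace \<Omega> V" "\<And>n. a n \<in> V"
  shows "mid a n \<in> V"
  unfolding mid_eq by (intro L2_subspace_scaleR[OF assms(1)] L2_subspace_add[OF assms(1)] assms(2))

lemma L2_subspace_Dt:
  assumes "L2_subspace \<Omega> V" "\<And>n. a n \<in> V"
  shows "Dt \<Delta>t a n \<in> V"
proof -
  have "(\<lambda>x. a (Suc n) x + (- 1) *\<^sub>R a n x) \<in> V"
    by (intro L2_subspace_scaleR[OF assms(1)] L2_subspace_add[OF assms(1)] assms(2))
  from L2_subspace_scaleR[OF assms(1) this, of "inverse \<Delta>t"] show ?thesis
    by (simp add: Dt_eq)
qed

text \<open>Testing \<open>g\<close> with itself shows that it vanishes, so that it is orthogonal also to fields outside \<open>V\<close>.\<close>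

lemma ip_eq_0_of_orthogonal_to_subspace:
  assumes "finite_measure (lebesgue_on \<Omega>)" "g \<in> V" "\<And>C. C \<in> V \<Longrightarrow> ip \<Omega> g C = 0"
    and "ess_bounded \<Omega> g" "ess_bounded \<Omega> z"
  shows "ip \<Omega> g z = 0"
proof -
  have "aeq \<Omega> g (\<lambda>x. 0)"
    using assms by (intro aeq_zero_if_ip_self_zero)
  then have "ip \<Omega> g z = ip \<Omega> (\<lambda>x. 0) z"
    using assms(4,5) by (intro ip_cong aeq_refl) (auto simp: ess_bounded_def)
  then show ?thesis by (simp add: ip_def)
qed

lemma ip_cross3_self: "ip \<Omega> (\<lambda>x. cross3 (v x) (w x)) w = 0"
  by (simp add: ip_def dot_cross_self)

lemma ip_cross3_swap:
  "ip \<Omega> (\<lambda>x. cross3 (v x) (w x)) z = - ip \<Omega> (\<lambda>x. cross3 (v x) (z x)) w"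
proof -
  have "cross3 (v x) (w x) \<bullet> z x = - (cross3 (v x) (z x) \<bullet> w x)" for x
    by (simp add: cross3_simps)
  then show ?thesis by (simp add: ip_def)
qed

section \<open>Conservation of the helicities\<close>

theorem theorem7:
  fixes \<Omega> :: "(real^3) set"
    and T :: "(real^3) set set"
    and Vg W :: "scalar_field set" and Vc Vd :: "vector_field set"
    and \<Delta>t c :: real and R_e R_m :: ereal
    and f :: "real \<Rightarrow> vector_field"
    and u B \<omega> j E H A :: "nat \<Rightarrow> vector_field" and P :: "nat \<Rightarrow> scalar_field"
  assumes "lipschitz_domain \<Omega>" and "bounded \<Omega>" and "contractible \<Omega>"
    and "mesh \<Omega> T" and "discrete_de_rham \<Omega> T Vg Vc Vd W"
    and "\<Delta>t > 0" and "c > 0" and "R_e > 0" and "R_m > 0"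
    and "\<And>t. t \<ge> 0 \<Longrightarrow> f t \<in> L2 \<Omega>"
    and "mhd_solution \<Omega> Vg Vc Vd \<Delta>t c R_e R_m f u B \<omega> j E H P"
    and "inverse R_e = 0" and "inverse R_m = 0"
    and "aeq \<Omega> (wdiv \<Omega> (B 0)) (\<lambda>x. 0)"
    and "\<And>n. ip \<Omega> (f (midtime \<Delta>t n)) (H n) = 0"
    and "\<And>n. A n \<in> Vc" and "\<And>n. aeq \<Omega> (wcurl \<Omega> (A n)) (B n)"
  shows "(\<forall>n. Dt_integral \<Omega> \<Delta>t B A n = 0) \<and>
         (\<forall>n. Dt_integral \<Omega> \<Delta>t B u n = 0) \<and>
         (\<forall>n. ip \<Omega> (B n) (A n) = ip \<Omega> (B 0) (A 0)) \<and>
         (\<forall>n. ip \<Omega> (B n) (u n) = ip \<Omega> (B 0) (u 0))"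
proof -
  have \<Omega>: "open \<Omega>" "bounded \<Omega>"
    using assms(1,2) by (auto simp: lipschitz_domain_def)
  have fin: "finite_measure (lebesgue_on \<Omega>)"
    by (rule finite_measure_lebesgue_on_bounded_open[OF \<Omega>])
  note complex = assms(5)[unfolded discrete_de_rham_def]
  have Vc: "fe_space \<Omega> T Vc" "Vc \<subseteq> H0_curl \<Omega>" and Vd: "fe_space \<Omega> T Vd"
    and grad_Vc: "\<And>q. q \<in> Vg \<Longrightarrow> wgrad \<Omega> q \<in> Vc"
    and curl_Vd: "\<And>v. v \<in> Vc \<Longrightarrow> wcurl \<Omega> v \<in> Vd"
    using complex by (simp_all add: image_subset_iff)
  have exact: "\<forall>v\<in>Vc. aeq \<Omega> (wcurl \<Omega> v) (\<lambda>x. 0) \<longleftrightarrow> (\<exists>q\<in>Vg. aeq \<Omega> v (wgrad \<Omega> q))"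
    using complex by (elim conjE)
  have sub: "L2_subspace \<Omega> Vc" "L2_subspace \<Omega> Vd"
    using Vc(1) Vd by (auto simp: fe_space_def)
  have fe: "v \<in> L2 \<Omega>" "piecewise_polynomial T v" if "v \<in> Vc \<or> v \<in> Vd" for v
    using that Vc(1) Vd by (auto simp: fe_space_def L2_subspace_def)
  have eb: "ess_bounded \<Omega> v" if "v \<in> Vc \<or> v \<in> Vd" for v
    using fe[OF that] by (rule ess_bounded_piecewise_polynomial[OF assms(4) \<Omega>])
  have curl_sym: "ip \<Omega> v (wcurl \<Omega> w) = ip \<Omega> (wcurl \<Omega> v) w" if "v \<in> Vc" "w \<in> Vc" for v w
    using that curl_Vd[OF that(1)] curl_Vd[OF that(2)] Vc(2)
    by (intro wcurl_symmetric[OF assms(4) \<Omega>] fe) auto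
  note scheme = assms(11)[unfolded mhd_solution_def assms(12,13)]
  note equations = scheme[THEN conjunct2, THEN spec]
  have mem: "u n \<in> Vc" "B n \<in> Vd" "\<omega> n \<in> Vc" "j n \<in> Vc" "E n \<in> Vc" "H n \<in> Vc" "P n \<in> Vg" for n
    using scheme[THEN conjunct1, THEN spec, of n] by simp_all
  have momentum: "ip \<Omega> (Dt \<Delta>t u n) v
        - ip \<Omega> (\<lambda>x. cross3 (mid u n x) (\<omega> n x)) v + ip \<Omega> (wgrad \<Omega> (P n)) v
        - c * ip \<Omega> (\<lambda>x. cross3 (j n x) (H n x)) v = ip \<Omega> (f (midtime \<Delta>t n)) v"
    if "v \<in> Vc" for n v
    using equations[of n, THEN conjunct1, THEN bspec, OF that] by simp
  have faraday: "ip \<Omega> (Dt \<Delta>t B n) C + ip \<Omega> (wcurl \<Omega> (E n)) C = 0" if "C \<in> Vd" for n C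
    using equations[of n, THEN conjunct2, THEN conjunct1, THEN bspec, OF that] .
  have ohm: "ip \<Omega> (\<lambda>x. - (E n x + cross3 (mid u n x) (H n x))) G = 0" if "G \<in> Vc" for n G
    using equations[of n, THEN conjunct2, THEN conjunct2, THEN conjunct1, THEN bspec, OF that] by simp
  have vorticity: "ip \<Omega> (\<omega> n) \<mu> = ip \<Omega> (wcurl \<Omega> (mid u n)) \<mu>" if "\<mu> \<in> Vc" for n \<mu>
    using equations[of n, THEN conjunct2, THEN conjunct2, THEN conjunct2, THEN conjunct1,
        THEN bspec, OF that] by simp
  have projection: "ip \<Omega> (mid B n) F = ip \<Omega> (H n) F" if "F \<in> Vc" for n F
    using equations[of n, THEN conjunct2, THEN conjunct2, THEN conjunct2, THEN conjunct2,
        THEN conjunct2, THEN conjunct1, THEN bspec, OF that] by simp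
  have mid_u: "mid u n \<in> Vc" and Dt_u: "Dt \<Delta>t u n \<in> Vc"
    and mid_B: "mid B n \<in> Vd" and Dt_B: "Dt \<Delta>t B n \<in> Vd" for n
    by (auto intro: L2_subspace_mid L2_subspace_Dt sub mem)
  \<comment> \<open>Without resistivity, Ohm's law says that \<open>E\<close> is the projection of \<open>- u \<times> H\<close>. Splitting the
    integral of the sum needs both products to be integrable, hence the essential bounds.\<close>
  have ohm': "ip \<Omega> (E n) G = - ip \<Omega> (\<lambda>x. cross3 (mid u n x) (H n x)) G" if G: "G \<in> Vc" for n G
  proof -
    have uH: "ess_bounded \<Omega> (\<lambda>x. cross3 (mid u n x) (H n x))"
      by (intro ess_bounded_cross3 eb) (use mid_u mem in auto)
    have "- ip \<Omega> (\<lambda>x. E n x + cross3 (mid u n x) (H n x)) G = 0"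
      using ohm[OF G, of n] ip_scaleR_left[of \<Omega> "-1" "\<lambda>x. E n x + cross3 (mid u n x) (H n x)" G]
      by simp
    then show ?thesis
      using ip_add_left[OF fin eb uH eb, of "E n" G] mem G by simp
  qed
  \<comment> \<open>Faraday's law is an identity of elements of \<open>Vd\<close>, so it may be paired with fields outside \<open>Vd\<close>;
    below these are the vector potential and the velocity, which lie in \<open>Vc\<close>.\<close>
  have faraday': "ip \<Omega> (Dt \<Delta>t B n) z = - ip \<Omega> (wcurl \<Omega> (E n)) z" if z: "ess_bounded \<Omega> z" for n z
  proof -
    have cE: "wcurl \<Omega> (E n) \<in> Vd" using curl_Vd mem by blast
    let ?g = "\<lambda>x. Dt \<Delta>t B n x + wcurl \<Omega> (E n) x"
    have split: "ip \<Omega> ?g y = ip \<Omega> (Dt \<Delta>t B n) y + ip \<Omega> (wcurl \<Omega> (E n)) y" if "ess_bounded \<Omega> y" for y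
      by (rule ip_add_left[OF fin eb[OF disjI2[OF Dt_B]] eb[OF disjI2[OF cE]] that])
    have g: "?g \<in> Vd"
      by (rule L2_subspace_add[OF sub(2) Dt_B cE])
    have "ip \<Omega> ?g C = 0" if "C \<in> Vd" for C
      using split[OF eb[OF disjI2[OF that]]] faraday[OF that] by simp
    then have "ip \<Omega> ?g z = 0"
      by (rule ip_eq_0_of_orthogonal_to_subspace[OF fin g _ eb[OF disjI2[OF g]] z])
    then show ?thesis using split[OF z] by simp
  qed
  have ebA: "ess_bounded \<Omega> (A n)" and ebB: "ess_bounded \<Omega> (B n)" and ebu: "ess_bounded \<Omega> (u n)" for n
    using eb mem assms(16) by blast+
  have potential: "ip \<Omega> (B n) v = ip \<Omega> (A n) (wcurl \<Omega> v)" if "v \<in> Vc" for n v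
  proof -
    have "ip \<Omega> (B n) v = ip \<Omega> (wcurl \<Omega> (A n)) v"
      using assms(17)[of n] ebB[of n] eb[of v] eb[of "wcurl \<Omega> (A n)"] curl_Vd[OF assms(16)] that
      by (intro ip_cong aeq_refl) (auto simp: ess_bounded_def aeq_def)
    then show ?thesis using curl_sym[OF assms(16) that] by simp
  qed
  \<comment> \<open>Magnetic helicity changes at the rate \<open>- 2 (E, B) = - 2 (E, H)\<close>, and \<open>E\<close> is orthogonal to
    \<open>H\<close> because \<open>u \<times> H\<close> is so pointwise.\<close>
  have magnetic: "Dt_integral \<Omega> \<Delta>t B A n = 0" for n
  proof -
    have curl_A: "ip \<Omega> v (wcurl \<Omega> (A k)) = ip \<Omega> v (B k)" if "v \<in> Vc" for v k
      using assms(17)[of k] ebB[of k] eb[of v] eb[of "wcurl \<Omega> (A k)"] curl_Vd[OF assms(16)] that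
      by (intro ip_cong aeq_refl) (auto simp: ess_bounded_def)
    have "ip \<Omega> (B n) (A (Suc n)) = ip \<Omega> (B (Suc n)) (A n)"
      using potential[OF assms(16), of n "Suc n"] curl_A[OF assms(16), of n "Suc n"]
      by (simp add: ip_commute)
    then have "Dt_integral \<Omega> \<Delta>t B A n = 2 * ip \<Omega> (Dt \<Delta>t B n) (mid A n)"
      by (intro Dt_integral_product_rule_symmetric fin ebB ebA)
    also have "ip \<Omega> (Dt \<Delta>t B n) (mid A n) = - ip \<Omega> (wcurl \<Omega> (E n)) (mid A n)"
      by (intro faraday' ess_bounded_mid ebA)
    also have "ip \<Omega> (wcurl \<Omega> (E n)) (mid A n) = ip \<Omega> (mid B n) (E n)"
    proof -
      have "ip \<Omega> (A k) (wcurl \<Omega> (E n)) = ip \<Omega> (B k) (E n)" for k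
        using potential mem by simp
      moreover have "ess_bounded \<Omega> (wcurl \<Omega> (E n))" "ess_bounded \<Omega> (E n)"
        using eb curl_Vd mem by blast+
      ultimately show ?thesis
        unfolding ip_commute[of \<Omega> "wcurl \<Omega> (E n)"]
        by (simp add: ip_mid_left[where a = A, OF fin ebA] ip_mid_left[where a = B, OF fin ebB])
    qed
    also have "\<dots> = ip \<Omega> (E n) (H n)"
      using projection[of "E n" n] mem by (simp add: ip_commute)
    also have "\<dots> = 0"
      using ohm'[OF mem(6), of n n] by (simp add: ip_cross3_self)
    finally show ?thesis by simp
  qed
  \<comment> \<open>The inductive and the inertial contribution to the cross helicity are both \<open>(u \<times> \<omega>, H)\<close>,
    with opposite signs.\<close>
  have cross: "Dt_integral \<Omega> \<Delta>t B u n = 0" for n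
  proof -
    have "ip \<Omega> (Dt \<Delta>t B n) (mid u n) = - ip \<Omega> (wcurl \<Omega> (E n)) (mid u n)"
      using mid_u eb by (intro faraday') blast
    also have "ip \<Omega> (wcurl \<Omega> (E n)) (mid u n) = ip \<Omega> (wcurl \<Omega> (mid u n)) (E n)"
      using curl_sym[OF mem(5) mid_u] by (simp add: ip_commute)
    also have "\<dots> = ip \<Omega> (E n) (\<omega> n)"
      using vorticity[of "E n" n] mem by (simp add: ip_commute)
    also have "\<dots> = ip \<Omega> (\<lambda>x. cross3 (mid u n x) (\<omega> n x)) (H n)"
      using ohm'[OF mem(3), of n n] ip_cross3_swap[of \<Omega> "mid u n" "H n" "\<omega> n"] by simp
    finally have induction_term:
      "ip \<Omega> (Dt \<Delta>t B n) (mid u n) = - ip \<Omega> (\<lambda>x. cross3 (mid u n x) (\<omega> n x)) (H n)" .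
    have "ip \<Omega> (wgrad \<Omega> (P n)) (H n) = ip \<Omega> (mid B n) (wgrad \<Omega> (P n))"
      using projection[OF grad_Vc[OF mem(7)], of n n] by (simp add: ip_commute)
    also have "\<dots> = 0"
    \<comment> \<open>The discrete field is solenoidal because it has a vector potential: the curl moves onto the
      gradient, where it vanishes by exactness.\<close>
    proof -
      have gP: "wgrad \<Omega> (P n) \<in> Vc" by (rule grad_Vc[OF mem(7)])
      have "aeq \<Omega> (wcurl \<Omega> (wgrad \<Omega> (P n))) (\<lambda>x. 0)"
        using bspec[OF exact gP] mem(7) aeq_refl by blast
      then have "ip \<Omega> (A k) (wcurl \<Omega> (wgrad \<Omega> (P n))) = ip \<Omega> (A k) (\<lambda>x. 0)" for k
        using ebA[of k] eb[of "wcurl \<Omega> (wgrad \<Omega> (P n))"] curl_Vd[OF gP]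
        by (intro ip_cong aeq_refl) (auto simp: ess_bounded_def)
      then have "ip \<Omega> (B k) (wgrad \<Omega> (P n)) = 0" for k
        using potential[OF gP] by (simp add: ip_def)
      then show ?thesis
        using ip_mid_left[where a = B and n = n, OF fin ebB eb[OF disjI1[OF gP]]] by simp
    qed
    finally have pressure_term: "ip \<Omega> (wgrad \<Omega> (P n)) (H n) = 0" .
    have "ip \<Omega> (mid B n) (Dt \<Delta>t u n) = ip \<Omega> (Dt \<Delta>t u n) (H n)"
      using projection[OF Dt_u, of n n] by (simp add: ip_commute)
    also have "\<dots> = ip \<Omega> (\<lambda>x. cross3 (mid u n x) (\<omega> n x)) (H n)"
      using momentum[OF mem(6), of n n] pressure_term assms(15)[of n] by (simp add: ip_cross3_self)
    finally show ?thesis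
      using induction_term by (simp add: Dt_integral_product_rule[where a = B and b = u, OF fin ebB ebu])
  qed
  have step: "ip \<Omega> (B (Suc n)) (A (Suc n)) = ip \<Omega> (B n) (A n)"
      "ip \<Omega> (B (Suc n)) (u (Suc n)) = ip \<Omega> (B n) (u n)" for n
    using magnetic[of n] cross[of n] assms(6) by (simp_all add: Dt_integral_def)
  have "ip \<Omega> (B n) (A n) = ip \<Omega> (B 0) (A 0)" "ip \<Omega> (B n) (u n) = ip \<Omega> (B 0) (u 0)" for n
    by (induction n) (simp_all add: step)
  then show ?thesis using magnetic cross by blast
qed

end
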